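(* Let $d\in\{2,3\}$, $\tau>0$, $\alpha>0$, and let $\Gamma_h^0,\Gamma_h^1,\dots,\Gamma_h^N$ be closed discrete surfaces (curves if $d=2$) in $\mathbb{R}^d$ such that for each $m=1,\dots,N$ one has $T_h^{m-1}\neq 0$ and $\Gamma_h^m=X_h^m(\Gamma_h^{m-1})$ with $X_h^m=\mathrm{id}+\tau v_h^m$, where $v_h^m\in (S_h^{m-1})^d$ is the solution of $$\int_{\Gamma_h^{m-1}}\nabla_{\Gamma_h^{m-1}}(\tau v_h^m+\mathrm{id})\cdot\nabla_{\Gamma_h^{m-1}}\eta_h+(v_h^m\cdot n_h^{m-1},\,n_h^{m-1}\cdot\eta_h)^{(h)}+\frac{(v_h^m,T_h^{m-1})^{(h)}\,(T_h^{m-1},\eta_h)^{(h)}}{\alpha\|T_h^{m-1}\|_{L^2_h}}=0\qquad\forall\,\eta_h\in (S_h^{m-1})^d.$$ Then $$|\Gamma_h^m|\le|\Gamma_h^{m-1}|\qquad\text{for } m=1,2,\dots,N,$$ where $|\Gamma_h^m|$ denotes the area (length if $d=2$) of $\Gamma_h^m$.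
   Context: Each $\Gamma_h^{m-1}$ is a closed (without boundary) oriented polyhedral hypersurface in $\mathbb{R}^d$: a finite union of nondegenerate simplices (flat triangles if $d=3$, straight segments if $d=2$) meeting conformingly along common faces. $S_h^{m-1}$ is the space of continuous real functions on $\Gamma_h^{m-1}$ that are linear (affine) on each simplex. $n_h^{m-1}$ is the piecewise constant unit normal (consistently oriented). $\mathrm{id}$ is the identity map of $\Gamma_h^{m-1}$; $\nabla_{\Gamma_h^{m-1}}$ is the elementwise tangential gradient, acting componentwise on vector fields, and $\cdot$ between gradients of vector fields is the Frobenius product. The simplices of $\Gamma_h^m$ are the images under the piecewise linear map $X_h^m$ of the simplices of $\Gamma_h^{m-1}$, and $|\Gamma_h^m|$ is the sum of the $\mathcal{H}^{d-1}$-measures of its simplices. Mass lumping on $\Gamma_h^{m-1}$: for functions $\eta,\chi$ that are continuous on each simplex (possibly jumping across simplices), $$(\eta,\chi)^{(h)}=\frac1d\sum_{l}|\sigma_l|\sum_{k=1}^d(\eta\cdot\chi)\bigl((\vec q_{l,k})^-\bigr),$$ where $\sigma_l$ runs over the (relatively open) simplices, $|\sigma_l|=\mathcal{H}^{d-1}(\sigma_l)$, $\vec q_{l,1},\dots,\vec q_{l,d}$ are the vertices of $\sigma_l$, and $(\vec q_{l,k})^-$ denotes the limit taken from inside $\sigma_l$; for vector-valued arguments the product is the Euclidean inner product. $\|f\|_{L^2_h}=\sqrt{(f,f)^{(h)}}$. The vector $T_h^{m-1}\in (S_h^{m-1})^d$ is defined by the problem: find $(T_h^{m-1},\mu_h^{m-1})\in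 (S_h^{m-1})^d\times S_h^{m-1}$ with $$(T_h^{m-1},\eta_h)^{(h)}+(\mu_h^{m-1}n_h^{m-1},\eta_h)^{(h)}=\int_{\Gamma_h^{m-1}}\nabla_{\Gamma_h^{m-1}}\mathrm{id}\cdot\nabla_{\Gamma_h^{m-1}}\eta_h\quad\forall\eta_h\in (S_h^{m-1})^d,$$ $$(T_h^{m-1},n_h^{m-1}\chi_h)^{(h)}=0\quad\forall\chi_h\in S_h^{m-1}.$$ *)

theory Defs
  imports "HOL-Analysis.Analysis"
begin

section \<open>Hausdorff measure\<close>

text \<open>The factor \<open>unit_ball_vol k / 2 ^ k\<close> normalises the \<open>k\<close>-dimensional Hausdorff measure so
  that it agrees with Lebesgue measure in dimension \<open>k\<close>. The empty set is treated separately only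
  for the sake of \<open>k = 0\<close>. Covering sets have to be required to be bounded because
  \<^const>\<open>diameter\<close> is meaningless on unbounded sets.\<close>

definition hausdorff_gauge :: "nat \<Rightarrow> 'a::metric_space set \<Rightarrow> ennreal" where
  "hausdorff_gauge k U =
     (if U = {} then 0 else ennreal (unit_ball_vol (real k) * (diameter U / 2) ^ k))"

definition hausdorff_premeasure :: "nat \<Rightarrow> real \<Rightarrow> 'a::metric_space set \<Rightarrow> ennreal" where
  "hausdorff_premeasure k \<delta> A =
     (INF U \<in> {U :: nat \<Rightarrow> 'a set. A \<subseteq> (\<Union>i. U i) \<and> (\<forall>i. bounded (U i) \<and> diameter (U i) \<le> \<delta>)}.
        \<Sum>i. hausdorff_gauge k (U i))"

definition hausdorff_outer :: "nat \<Rightarrow> 'a::metric_space set \<Rightarrow> ennreal" where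
  "hausdorff_outer k A = (SUP \<delta>\<in>{0<..}. hausdorff_premeasure k \<delta> A)"

text \<open>This is a metric outer measure, hence countably additive on Borel sets.\<close>

definition hausdorff_measure :: "nat \<Rightarrow> 'a::metric_space measure" where
  "hausdorff_measure k = measure_of UNIV (sets borel) (hausdorff_outer k)"


section \<open>Closed oriented polyhedral hypersurfaces\<close>

text \<open>A simplex is given by its set of vertices. The unit normal is a function of the point; only
  its values on the relatively open simplices are meaningful.\<close>

record ('d::finite) discrete_surface =
  simplices :: "(real ^ 'd) set set"
  normal :: "real ^ 'd \<Rightarrow> real ^ 'd"

definition open_simplex :: "(real ^ 'd) set \<Rightarrow> (real ^ 'd) set" where
  "open_simplex \<sigma> = rel_interior (convex hull \<sigma>)"

definition tangent_space :: "(real ^ 'd) set \<Rightarrow> (real ^ 'd) set" where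
  "tangent_space \<sigma> = span {p - q | p q. p \<in> \<sigma> \<and> q \<in> \<sigma>}"

definition points :: "'d::finite discrete_surface \<Rightarrow> (real ^ 'd) set" where
  "points G = (\<Union>\<sigma>\<in>simplices G. convex hull \<sigma>)"

definition conforming_simplices :: "'d::finite discrete_surface \<Rightarrow> bool" where
  "conforming_simplices G \<longleftrightarrow>
     finite (simplices G) \<and>
     (\<forall>\<sigma>\<in>simplices G. card \<sigma> = CARD('d) \<and> \<not> affine_dependent \<sigma>) \<and>
     (\<forall>\<sigma>\<in>simplices G. \<forall>\<rho>\<in>simplices G.
        convex hull \<sigma> \<inter> convex hull \<rho> = convex hull (\<sigma> \<inter> \<rho>))"

text \<open>Locally Euclidean of dimension \<open>d - 1\<close> without boundary. In particular every
  \<open>(d - 2)\<close>-dimensional face belongs to exactly two simplices. Compactness is automatic, as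
  there are finitely many simplices.\<close>

definition hypersurface_without_boundary :: "'d::finite discrete_surface \<Rightarrow> bool" where
  "hypersurface_without_boundary G \<longleftrightarrow>
     (\<forall>x\<in>points G. \<exists>U H :: (real ^ 'd) set.
        x \<in> U \<and> openin (top_of_set (points G)) U \<and>
        subspace H \<and> dim H = CARD('d) - 1 \<and> U homeomorphic H)"

definition unit_normal_field :: "'d::finite discrete_surface \<Rightarrow> bool" where
  "unit_normal_field G \<longleftrightarrow>
     (\<forall>\<sigma>\<in>simplices G. \<exists>\<nu>. norm \<nu> = 1 \<and> (\<forall>t\<in>tangent_space \<sigma>. \<nu> \<bullet> t = 0) \<and>
        (\<forall>x\<in>open_simplex \<sigma>. normal G x = \<nu>))"

text \<open>With respect to a unit normal \<open>\<nu>\<close>, the ordering \<open>e\<close> of the vertices of a simplex is positive or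
  negative according to the sign of the determinant with \<open>\<nu>\<close> in row \<open>k\<close> and the edge vectors
  \<open>e i - e k\<close> in the other rows. This sign does not depend on the choice of \<open>k\<close>.\<close>

definition orientation_det :: "real ^ 'd \<Rightarrow> ('d::finite \<Rightarrow> real ^ 'd) \<Rightarrow> 'd \<Rightarrow> real" where
  "orientation_det \<nu> e k = det (\<chi> i. if i = k then \<nu> else e i - e k)"

text \<open>Two neighbouring simplices are ordered so that the common face is listed identically in both
  and the opposite vertices are in position \<open>k\<close>. The normals are consistent iff the simplices then
  induce opposite orientations on the common face. (For coplanar neighbours, this says that
  the normals are equal.)\<close>

definition consistent_orientation :: "'d::finite discrete_surface \<Rightarrow> bool" where
  "consistent_orientation G \<longleftrightarrow>
     (\<forall>\<sigma>\<in>simplices G. \<forall>\<rho>\<in>simplices G. \<forall>e f :: 'd \<Rightarrow> real ^ 'd. \<forall>k.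
        \<sigma> \<noteq> \<rho> \<and> bij_betw e UNIV \<sigma> \<and> bij_betw f UNIV \<rho> \<and> (\<forall>i. i \<noteq> k \<longrightarrow> e i = f i) \<longrightarrow>
        (\<forall>x\<in>open_simplex \<sigma>. \<forall>y\<in>open_simplex \<rho>.
           orientation_det (normal G x) e k * orientation_det (normal G y) f k < 0))"

definition closed_discrete_surface :: "'d::finite discrete_surface \<Rightarrow> bool" where
  "closed_discrete_surface G \<longleftrightarrow>
     conforming_simplices G \<and> hypersurface_without_boundary G \<and>
     unit_normal_field G \<and> consistent_orientation G"

definition simplex_area :: "(real ^ 'd) set \<Rightarrow> real" where
  "simplex_area \<sigma> = measure (hausdorff_measure (CARD('d) - 1)) (open_simplex \<sigma>)"

definition surface_area :: "'d::finite discrete_surface \<Rightarrow> real" where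
  "surface_area G = (\<Sum>\<sigma>\<in>simplices G. simplex_area \<sigma>)"


section \<open>Finite element spaces and forms\<close>

text \<open>Functions on the surface are total functions on the ambient space; only their values on
  \<^term>\<open>points G\<close> matter.\<close>

definition fe_space :: "'d::finite discrete_surface \<Rightarrow> (real ^ 'd \<Rightarrow> real) set" where
  "fe_space G = {f. continuous_on (points G) f \<and>
     (\<forall>\<sigma>\<in>simplices G. \<exists>a b. \<forall>x\<in>convex hull \<sigma>. f x = a \<bullet> x + b)}"

definition fe_vector_space :: "'d::finite discrete_surface \<Rightarrow> (real ^ 'd \<Rightarrow> real ^ 'd) set" where
  "fe_vector_space G = {f. \<forall>i. (\<lambda>x. f x $ i) \<in> fe_space G}"

definition tangential_gradient ::
    "(real ^ 'd) set \<Rightarrow> (real ^ 'd \<Rightarrow> real) \<Rightarrow> real ^ 'd \<Rightarrow> real ^ 'd" where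
  "tangential_gradient \<sigma> f x =
     (THE g. g \<in> tangent_space \<sigma> \<and>
        (f has_derivative (\<lambda>h. g \<bullet> h)) (at x within open_simplex \<sigma>))"

definition gradient_product ::
    "(real ^ 'd) set \<Rightarrow> (real ^ 'd \<Rightarrow> real ^ 'd) \<Rightarrow> (real ^ 'd \<Rightarrow> real ^ 'd) \<Rightarrow> real ^ 'd \<Rightarrow> real" where
  "gradient_product \<sigma> u w x =
     (\<Sum>i\<in>UNIV. tangential_gradient \<sigma> (\<lambda>y. u y $ i) x \<bullet> tangential_gradient \<sigma> (\<lambda>y. w y $ i) x)"

definition dirichlet_form ::
    "'d::finite discrete_surface \<Rightarrow> (real ^ 'd \<Rightarrow> real ^ 'd) \<Rightarrow> (real ^ 'd \<Rightarrow> real ^ 'd) \<Rightarrow> real" where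
  "dirichlet_form G u w =
     (\<Sum>\<sigma>\<in>simplices G.
        LINT x : open_simplex \<sigma> | hausdorff_measure (CARD('d) - 1). gradient_product \<sigma> u w x)"

text \<open>For real-valued arguments, \<open>\<bullet>\<close> is multiplication.\<close>

definition lumped ::
    "'d::finite discrete_surface \<Rightarrow> (real ^ 'd \<Rightarrow> 'b::real_inner) \<Rightarrow> (real ^ 'd \<Rightarrow> 'b) \<Rightarrow> real" where
  "lumped G \<eta> \<xi> =
     1 / real CARD('d) * (\<Sum>\<sigma>\<in>simplices G. simplex_area \<sigma> *
        (\<Sum>q\<in>\<sigma>. Lim (at q within open_simplex \<sigma>) (\<lambda>x. \<eta> x \<bullet> \<xi> x)))"

definition lumped_norm :: "'d::finite discrete_surface \<Rightarrow> (real ^ 'd \<Rightarrow> 'b::real_inner) \<Rightarrow> real" where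
  "lumped_norm G f = sqrt (lumped G f f)"

text \<open>The component \<open>T\<close> of a solution \<open>(T, \<mu>)\<close> is always unique on the surface, whereas \<open>\<mu>\<close> is not
  at vertices where the area-weighted sum of the adjacent normals vanishes.\<close>

definition solves_T_problem :: "'d::finite discrete_surface \<Rightarrow> (real ^ 'd \<Rightarrow> real ^ 'd) \<Rightarrow> bool" where
  "solves_T_problem G T \<longleftrightarrow>
     T \<in> fe_vector_space G \<and>
     (\<exists>\<mu>\<in>fe_space G.
        (\<forall>\<eta>\<in>fe_vector_space G.
           lumped G T \<eta> + lumped G (\<lambda>x. \<mu> x *\<^sub>R normal G x) \<eta> = dirichlet_form G (\<lambda>x. x) \<eta>) \<and>
        (\<forall>\<xi>\<in>fe_space G. lumped G T (\<lambda>x. \<xi> x *\<^sub>R normal G x) = 0))"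

definition solves_velocity_problem ::
    "real \<Rightarrow> real \<Rightarrow> 'd::finite discrete_surface \<Rightarrow> (real ^ 'd \<Rightarrow> real ^ 'd) \<Rightarrow>
       (real ^ 'd \<Rightarrow> real ^ 'd) \<Rightarrow> bool" where
  "solves_velocity_problem \<tau> \<alpha> G T v \<longleftrightarrow>
     v \<in> fe_vector_space G \<and>
     (\<forall>\<eta>\<in>fe_vector_space G.
        dirichlet_form G (\<lambda>x. \<tau> *\<^sub>R v x + x) \<eta>
        + lumped G (\<lambda>x. v x \<bullet> normal G x) (\<lambda>x. normal G x \<bullet> \<eta> x)
        + lumped G v T * lumped G T \<eta> / (\<alpha> * lumped_norm G T) = 0)"

text \<open>A map that is affine on each simplex carries simplices to simplices, so the image mesh is
  determined by the images of the vertices.\<close>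

definition image_simplices ::
    "(real ^ 'd \<Rightarrow> real ^ 'd) \<Rightarrow> 'd::finite discrete_surface \<Rightarrow> (real ^ 'd) set set" where
  "image_simplices X G = (\<lambda>\<sigma>. X ` \<sigma>) ` simplices G"

end

theory Submission
  imports Defs
begin

text \<open>
  The velocity equation is tested with the displacement \<open>w = \<tau> v\<close> itself. The normal term then becomes
  a sum of squares, the \<open>T\<close>-term becomes a square divided by the nonnegative number
  \<open>\<alpha> \<parallel>T\<parallel>\<close>, and both keep a nonnegative sign because \<open>\<tau> > 0\<close>. Hence the Dirichlet form satisfies
  \<open>\<langle>\<nabla>X, \<nabla>(X - id)\<rangle> \<le> 0\<close> for \<open>X = id + w\<close> (lemma \<open>dirichlet_form_velocity_nonpos\<close>). It remains to see
  that this form dominates the increase of area, simplex by simplex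
  (lemma \<open>simplex_area_increase_le\<close>).

  On one simplex let \<open>B\<close> be the matrix of the linear part of \<open>X\<close> with respect to orthonormal bases of
  the tangent spaces of the simplex and of its image, and let \<open>n = d - 1\<close>. Completing the square
  gives \<open>\<nabla>X \<cdot> \<nabla>(X - id) \<ge> (|B|\<^sup>2 - n) / 2\<close> in the Frobenius norm, and for \<open>n \<in> {1, 2}\<close> the
  arithmetic-geometric mean inequality gives \<open>|det B| - 1 \<le> (|B|\<^sup>2 - n) / 2\<close>. This is where the
  restriction of the dimension enters: for \<open>n \<ge> 3\<close> the Dirichlet energy no longer dominates the area.

  The remaining ingredient is that \<open>X\<close> multiplies the area of the simplex by \<open>|det B|\<close>
  (lemma \<open>simplex_area_affine_image\<close>). Since area is the \<open>n\<close>-dimensional Hausdorff measure, this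
  rests on three facts: Hausdorff outer measure is countably additive on Borel sets; it is invariant
  under isometric embeddings, which transports both simplices to \<open>\<real>\<^sup>n\<close>; and on \<open>\<real>\<^sup>n\<close> it is a finite
  translation invariant Borel measure, hence a constant multiple of Lebesgue measure. The
  constant is the same for both simplices, so it cancels from the ratio of their areas.
\<close>

section \<open>Hausdorff outer measure\<close>

lemma diameter_nonexpansive_image:
  assumes "bounded S" and f: "\<And>x y. x \<in> S \<Longrightarrow> y \<in> S \<Longrightarrow> dist (f x) (f y) \<le> dist x y"
  shows "bounded (f ` S)" and "diameter (f ` S) \<le> diameter S"
proof -
  have le: "dist (f x) (f y) \<le> diameter S" if "x \<in> S" "y \<in> S" for x y
    using f[OF that] diameter_bounded_bound[OF assms(1) that] by linarith
  then show "bounded (f ` S)"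
    unfolding bounded_two_points by blast
  show "diameter (f ` S) \<le> diameter S"
  proof (cases "S = {}")
    case False
    then show ?thesis
      using le by (auto simp: diameter_def[of "f ` S"] intro!: cSUP_least)
  qed simp
qed

text \<open>The implication on emptiness matters for \<open>k = 0\<close>, where a nonempty set of diameter \<open>0\<close> has
  gauge \<open>1\<close>.\<close>

lemma hausdorff_gauge_mono:
  assumes "bounded U" "bounded V" "diameter V \<le> diameter U" "U = {} \<Longrightarrow> V = {}"
  shows "hausdorff_gauge k V \<le> hausdorff_gauge k U"
  using assms diameter_ge_0[OF assms(2)]
  by (auto simp: hausdorff_gauge_def intro!: ennreal_leI mult_left_mono power_mono)

lemma hausdorff_gauge_empty [simp]: "hausdorff_gauge k {} = 0"
  by (simp add: hausdorff_gauge_def)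

lemma hausdorff_premeasure_le:
  assumes "A \<subseteq> (\<Union>i. U i)" "\<And>i::nat. bounded (U i)" "\<And>i. diameter (U i) \<le> \<delta>"
  shows "hausdorff_premeasure k \<delta> A \<le> (\<Sum>i. hausdorff_gauge k (U i))"
  unfolding hausdorff_premeasure_def using assms by (intro INF_lower) auto

lemma hausdorff_premeasure_closeE:
  assumes "hausdorff_premeasure k \<delta> A < e"
  obtains U :: "nat \<Rightarrow> _" where "A \<subseteq> (\<Union>i. U i)" "\<And>i. bounded (U i)" "\<And>i. diameter (U i) \<le> \<delta>"
    "(\<Sum>i. hausdorff_gauge k (U i)) < e"
  using assms unfolding hausdorff_premeasure_def INF_less_iff by auto

lemma hausdorff_premeasure_greatest:
  assumes "\<And>U :: nat \<Rightarrow> _. A \<subseteq> (\<Union>i. U i) \<Longrightarrow> (\<And>i. bounded (U i)) \<Longrightarrow> (\<And>i. diameter (U i) \<le> \<delta>) \<Longrightarrow>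
     c \<le> (\<Sum>i. hausdorff_gauge k (U i))"
  shows "c \<le> hausdorff_premeasure k \<delta> A"
  unfolding hausdorff_premeasure_def using assms by (intro INF_greatest) auto

lemma hausdorff_premeasure_antimono:
  assumes "\<delta> \<le> \<epsilon>"
  shows "hausdorff_premeasure k \<epsilon> A \<le> hausdorff_premeasure k \<delta> A"
proof (rule hausdorff_premeasure_greatest)
  fix U :: "nat \<Rightarrow> 'a set"
  assume "A \<subseteq> (\<Union>i. U i)" "\<And>i. bounded (U i)" "\<And>i. diameter (U i) \<le> \<delta>"
  then show "hausdorff_premeasure k \<epsilon> A \<le> (\<Sum>i. hausdorff_gauge k (U i))"
    using assms by (intro hausdorff_premeasure_le) (auto intro: order_trans)
qed

lemma hausdorff_premeasure_le_outer:
  "0 < \<delta> \<Longrightarrow> hausdorff_premeasure k \<delta> A \<le> hausdorff_outer k A"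
  unfolding hausdorff_outer_def by (intro SUP_upper) auto

lemma hausdorff_outer_least:
  "(\<And>\<delta>. 0 < \<delta> \<Longrightarrow> hausdorff_premeasure k \<delta> A \<le> c) \<Longrightarrow> hausdorff_outer k A \<le> c"
  unfolding hausdorff_outer_def by (intro SUP_least) auto

text \<open>The images of the sets of a cover of \<open>A\<close> cover \<open>f ` A\<close> and have no larger diameters. The sets
  of the cover are intersected with \<open>A\<close> first, since \<open>f\<close> is controlled only there.\<close>

lemma hausdorff_outer_nonexpansive_image:
  fixes f :: "'a::metric_space \<Rightarrow> 'b::metric_space"
  assumes f: "\<And>x y. x \<in> A \<Longrightarrow> y \<in> A \<Longrightarrow> dist (f x) (f y) \<le> dist x y"
  shows "hausdorff_outer k (f ` A) \<le> hausdorff_outer k A"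
proof (rule hausdorff_outer_least)
  fix \<delta> :: real assume \<delta>: "0 < \<delta>"
  have "hausdorff_premeasure k \<delta> (f ` A) \<le> hausdorff_premeasure k \<delta> A"
  proof (rule hausdorff_premeasure_greatest)
    fix U :: "nat \<Rightarrow> 'a set"
    assume U: "A \<subseteq> (\<Union>i. U i)" "\<And>i. bounded (U i)" "\<And>i. diameter (U i) \<le> \<delta>"
    define V where "V i = f ` (U i \<inter> A)" for i
    have b: "bounded (U i \<inter> A)" for i
      using U(2) by (rule bounded_subset) auto
    have d: "diameter (U i \<inter> A) \<le> diameter (U i)" for i
      using U(2) by (intro diameter_subset) auto
    have V: "bounded (V i)" "diameter (V i) \<le> diameter (U i)" for i
      using diameter_nonexpansive_image[where S = "U i \<inter> A" and f = f, OF b] f d[of i] unfolding V_def by force+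
    have "hausdorff_premeasure k \<delta> (f ` A) \<le> (\<Sum>i. hausdorff_gauge k (V i))"
    proof (rule hausdorff_premeasure_le)
      show "f ` A \<subseteq> (\<Union>i. V i)"
        using U(1) by (fastforce simp: V_def)
      show "diameter (V i) \<le> \<delta>" for i
        using V(2) U(3) order_trans by blast
    qed (rule V)
    also have "\<dots> \<le> (\<Sum>i. hausdorff_gauge k (U i))"
      using U V by (intro suminf_le hausdorff_gauge_mono) (auto simp: V_def)
    finally show "hausdorff_premeasure k \<delta> (f ` A) \<le> (\<Sum>i. hausdorff_gauge k (U i))" .
  qed
  then show "hausdorff_premeasure k \<delta> (f ` A) \<le> hausdorff_outer k A"
    using hausdorff_premeasure_le_outer[OF \<delta>] order_trans by blast
qed

lemma hausdorff_outer_isometric_image: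
  fixes f :: "'a::metric_space \<Rightarrow> 'b::metric_space"
  assumes f: "\<And>x y. dist (f x) (f y) = dist x y"
  shows "hausdorff_outer k (f ` A) = hausdorff_outer k A"
proof (rule antisym)
  have inj: "inj f"
    by (metis f dist_eq_0_iff injI)
  have "hausdorff_outer k (inv f ` f ` A) \<le> hausdorff_outer k (f ` A)"
    by (rule hausdorff_outer_nonexpansive_image) (use f inj in auto)
  then show "hausdorff_outer k A \<le> hausdorff_outer k (f ` A)"
    by (simp add: inj image_image)
qed (auto intro: hausdorff_outer_nonexpansive_image simp: f)

lemma hausdorff_outer_mono: "A \<subseteq> B \<Longrightarrow> hausdorff_outer k A \<le> hausdorff_outer k B"
proof (rule hausdorff_outer_least)
  fix \<delta> :: real assume "A \<subseteq> B" "0 < \<delta>"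
  then have "hausdorff_premeasure k \<delta> A \<le> hausdorff_premeasure k \<delta> B"
    by (intro hausdorff_premeasure_greatest hausdorff_premeasure_le) auto
  with \<open>0 < \<delta>\<close> show "hausdorff_premeasure k \<delta> A \<le> hausdorff_outer k B"
    using hausdorff_premeasure_le_outer order_trans by blast
qed

lemma hausdorff_outer_empty: "hausdorff_outer k {} = 0"
proof -
  have "hausdorff_premeasure k \<delta> ({} :: 'a set) \<le> 0" if "0 < \<delta>" for \<delta>
    using hausdorff_premeasure_le[of "{}" "\<lambda>_. {} :: 'a set" \<delta> k] that by simp
  then show ?thesis
    using hausdorff_outer_least[of k "{} :: 'a set" 0] by simp
qed

text \<open>As for every outer measure that is defined by covers: near-optimal covers of the sets \<open>A n\<close>, with
  errors that sum up to \<open>e\<close>, are merged into a single sequence.\<close>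

lemma hausdorff_premeasure_UN_le:
  fixes A :: "nat \<Rightarrow> 'a::metric_space set"
  shows "hausdorff_premeasure k \<delta> (\<Union>n. A n) \<le> (\<Sum>n. hausdorff_premeasure k \<delta> (A n))"
proof (rule ennreal_le_epsilon)
  let ?h = "hausdorff_premeasure k \<delta>"
  fix e :: real assume "0 < e" "(\<Sum>n. ?h (A n)) < top"
  then have *: "?h (A n) < ?h (A n) + e * (1/2)^Suc n" for n
    by (auto simp add: less_top dest!: ennreal_suminf_lessD)
  have "\<exists>U :: nat \<Rightarrow> 'a set. A n \<subseteq> (\<Union>i. U i) \<and> (\<forall>i. bounded (U i)) \<and> (\<forall>i. diameter (U i) \<le> \<delta>) \<and>
     (\<Sum>i. hausdorff_gauge k (U i)) \<le> ?h (A n) + e * (1/2)^Suc n" for n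
    by (rule hausdorff_premeasure_closeE[OF *[of n]]) (blast intro: less_imp_le)
  then obtain B :: "nat \<Rightarrow> nat \<Rightarrow> 'a set"
    where B: "\<And>n. A n \<subseteq> (\<Union>i. B n i)" "\<And>n i. bounded (B n i)" "\<And>n i. diameter (B n i) \<le> \<delta>"
      and Ble: "\<And>n. (\<Sum>i. hausdorff_gauge k (B n i)) \<le> ?h (A n) + e * (1/2)^Suc n"
    by metis
  define C where "C = case_prod B o prod_decode"
  have "?h (\<Union>n. A n) \<le> (\<Sum>i. hausdorff_gauge k (C i))"
  proof (rule hausdorff_premeasure_le)
    show "(\<Union>n. A n) \<subseteq> (\<Union>i. C i)"
      using B(1) by (auto simp add: C_def subset_eq) (metis prod.case prod_encode_inverse)
  qed (auto simp: C_def B split: prod.split)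
  also have "\<dots> = (\<Sum>n. \<Sum>i. hausdorff_gauge k (B n i))"
    unfolding C_def comp_def by (intro suminf_ennreal_2dimen) auto
  also have "\<dots> \<le> (\<Sum>n. ?h (A n) + e * (1/2) ^ Suc n)"
    by (intro suminf_le Ble) auto
  also have "\<dots> = (\<Sum>n. ?h (A n)) + (\<Sum>n. ennreal e * ennreal ((1/2) ^ Suc n))"
    using \<open>0 < e\<close> by (subst suminf_add[symmetric])
      (auto simp del: ennreal_suminf_cmult simp add: ennreal_mult[symmetric])
  also have "\<dots> = (\<Sum>n. ?h (A n)) + e"
    unfolding ennreal_suminf_cmult
    by (subst suminf_ennreal_eq[OF zero_le_power power_half_series]) auto
  finally show "?h (\<Union>n. A n) \<le> (\<Sum>n. ?h (A n)) + e" .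
qed

lemma hausdorff_outer_UN_le:
  fixes A :: "nat \<Rightarrow> 'a::metric_space set"
  shows "hausdorff_outer k (\<Union>n. A n) \<le> (\<Sum>n. hausdorff_outer k (A n))"
proof (rule hausdorff_outer_least)
  fix \<delta> :: real assume "0 < \<delta>"
  then have "(\<Sum>n. hausdorff_premeasure k \<delta> (A n)) \<le> (\<Sum>n. hausdorff_outer k (A n))"
    by (intro suminf_le hausdorff_premeasure_le_outer) auto
  then show "hausdorff_premeasure k \<delta> (\<Union>n. A n) \<le> (\<Sum>n. hausdorff_outer k (A n))"
    by (rule order_trans[OF hausdorff_premeasure_UN_le])
qed

lemma outer_measure_space_hausdorff: "outer_measure_space (Pow UNIV) (hausdorff_outer k)"
  by (auto simp: outer_measure_space_def positive_def increasing_def countably_subadditive_def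
      hausdorff_outer_empty intro: hausdorff_outer_mono hausdorff_outer_UN_le)

lemma hausdorff_outer_Un_le: "hausdorff_outer k (A \<union> B) \<le> hausdorff_outer k A + hausdorff_outer k B"
proof -
  have "subadditive (Pow UNIV) (hausdorff_outer k)"
    using ring_of_sets.countably_subadditive_subadditive[OF ring_of_sets_Pow] outer_measure_space_hausdorff
    by (metis outer_measure_space_def)
  then have "hausdorff_outer k (A \<union> (B - A)) \<le> hausdorff_outer k A + hausdorff_outer k (B - A)"
    by (rule subadditiveD) auto
  also have "\<dots> \<le> hausdorff_outer k A + hausdorff_outer k B"
    by (intro add_left_mono hausdorff_outer_mono) auto
  finally show ?thesis
    by simp
qed

text \<open>A set of diameter less than the distance of \<open>A\<close> and \<open>B\<close> cannot meet both of them, so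
  a fine cover of \<open>A \<union> B\<close> splits into a cover of \<open>A\<close> and a cover of \<open>B\<close>.\<close>

lemma hausdorff_premeasure_separated:
  fixes A B :: "'a::metric_space set"
  assumes sep: "\<And>x y. x \<in> A \<Longrightarrow> y \<in> B \<Longrightarrow> \<delta> < dist x y"
  shows "hausdorff_premeasure k \<delta> A + hausdorff_premeasure k \<delta> B \<le> hausdorff_premeasure k \<delta> (A \<union> B)"
proof (rule hausdorff_premeasure_greatest)
  fix U :: "nat \<Rightarrow> 'a set"
  assume U: "A \<union> B \<subseteq> (\<Union>i. U i)" "\<And>i. bounded (U i)" "\<And>i. diameter (U i) \<le> \<delta>"
  have "0 \<le> \<delta>"
    using U(2,3) diameter_ge_0 order_trans by blast
  define V where "V C i = (if U i \<inter> C = {} then {} else U i)" for C i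
  have cover: "hausdorff_premeasure k \<delta> C \<le> (\<Sum>i. hausdorff_gauge k (V C i))" if "C \<subseteq> A \<union> B" for C
  proof (rule hausdorff_premeasure_le)
    show "C \<subseteq> (\<Union>i. V C i)"
      using that U(1) by (fastforce simp: V_def)
  qed (use U \<open>0 \<le> \<delta>\<close> in \<open>auto simp: V_def\<close>)
  have "hausdorff_gauge k (V A i) + hausdorff_gauge k (V B i) \<le> hausdorff_gauge k (U i)" for i
  proof -
    have "U i \<inter> A = {} \<or> U i \<inter> B = {}"
    proof (rule ccontr)
      assume "\<not> ?thesis"
      then obtain x y where xy: "x \<in> U i" "x \<in> A" "y \<in> U i" "y \<in> B"
        by auto
      then have "dist x y \<le> \<delta>"
        using diameter_bounded_bound[OF U(2)] U(3) order_trans by blast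
      then show False
        using sep xy by force
    qed
    then show ?thesis
      by (auto simp: V_def)
  qed
  then have "(\<Sum>i. hausdorff_gauge k (V A i) + hausdorff_gauge k (V B i)) \<le> (\<Sum>i. hausdorff_gauge k (U i))"
    by (intro suminf_le) auto
  then show "hausdorff_premeasure k \<delta> A + hausdorff_premeasure k \<delta> B \<le> (\<Sum>i. hausdorff_gauge k (U i))"
    using add_mono[OF cover[of A] cover[of B]] by (simp add: suminf_add order_trans)
qed

text \<open>Sets at positive distance: the inequality for the premeasures holds for all sufficiently small
  \<open>\<delta>\<close> and survives the supremum because the premeasures increase as \<open>\<delta>\<close> decreases.\<close>

lemma hausdorff_outer_separated:
  fixes A B :: "'a::metric_space set"
  assumes "0 < e" and sep: "\<And>x y. x \<in> A \<Longrightarrow> y \<in> B \<Longrightarrow> e \<le> dist x y"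
  shows "hausdorff_outer k A + hausdorff_outer k B \<le> hausdorff_outer k (A \<union> B)"
proof -
  let ?h = "hausdorff_premeasure k"
  have dir: "\<exists>l\<in>{0<..}. ?h i A + ?h j B \<le> ?h l A + ?h l B" if "i \<in> {0<..}" "j \<in> {0<..}" for i j
    using that by (intro bexI[of _ "min i j"] add_mono hausdorff_premeasure_antimono) auto
  have "hausdorff_outer k A + hausdorff_outer k B = (SUP \<delta>\<in>{0<..}. ?h \<delta> A + ?h \<delta> B)"
    unfolding hausdorff_outer_def by (rule SUP_add_directed_ennreal[symmetric]) (rule dir)
  also have "\<dots> \<le> hausdorff_outer k (A \<union> B)"
  proof (rule SUP_least)
    fix \<delta> :: real assume "\<delta> \<in> {0<..}"
    define \<epsilon> where "\<epsilon> = min \<delta> (e / 2)"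
    have \<epsilon>: "0 < \<epsilon>" "\<epsilon> < e" "\<epsilon> \<le> \<delta>"
      using \<open>0 < e\<close> \<open>\<delta> \<in> {0<..}\<close> by (auto simp: \<epsilon>_def)
    have "?h \<delta> A + ?h \<delta> B \<le> ?h \<epsilon> A + ?h \<epsilon> B"
      using \<epsilon> by (intro add_mono hausdorff_premeasure_antimono)
    also have "\<dots> \<le> ?h \<epsilon> (A \<union> B)"
      using sep \<epsilon> by (intro hausdorff_premeasure_separated) force
    also have "\<dots> \<le> hausdorff_outer k (A \<union> B)"
      using \<epsilon> by (intro hausdorff_premeasure_le_outer)
    finally show "?h \<delta> A + ?h \<delta> B \<le> hausdorff_outer k (A \<union> B)" .
  qed
  finally show ?thesis .
qed

section \<open>Borel sets are measurable\<close>

text \<open>For a \<open>1\<close>-Lipschitz function \<open>u\<close> the rings \<open>t (i + 2) < u \<le> t (i + 1)\<close> with indices of the same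
  parity are at positive distance from each other, so their outer measures add up. The parameter \<open>p\<close>
  chooses the parity.\<close>

lemma hausdorff_outer_rings_le:
  fixes u :: "'a::metric_space \<Rightarrow> real" and t :: "nat \<Rightarrow> real"
  assumes u: "\<And>x y. u x - u y \<le> dist x y" and t: "\<And>n. t (Suc n) < t n"
  shows "(\<Sum>j<n. hausdorff_outer k {x\<in>A. t ((2*j + p) + 2) < u x \<and> u x \<le> t ((2*j + p) + 1)})
           \<le> hausdorff_outer k {x\<in>A. t (2*n + p) < u x}"
proof (induction n)
  case (Suc n)
  define P where "P = {x\<in>A. t (2*n + p) < u x}"
  define R where "R = {x\<in>A. t (2*n + p + 2) < u x \<and> u x \<le> t (2*n + p + 1)}"
  have mono: "t (2*n + p + 2) < t (2*n + p)"
    using t[of "2*n+p"] t[of "2*n+p+1"] by simp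
  have "(\<Sum>j<Suc n. hausdorff_outer k {x\<in>A. t ((2*j + p) + 2) < u x \<and> u x \<le> t ((2*j + p) + 1)})
      \<le> hausdorff_outer k P + hausdorff_outer k R"
    using Suc unfolding P_def R_def by (simp add: add_right_mono)
  also have "\<dots> \<le> hausdorff_outer k (P \<union> R)"
  proof (rule hausdorff_outer_separated)
    show "0 < t (2*n + p) - t (2*n + p + 1)"
      using t[of "2*n+p"] by simp
    fix x y assume "x \<in> P" "y \<in> R"
    then show "t (2*n + p) - t (2*n + p + 1) \<le> dist x y"
      using u[of x y] by (auto simp: P_def R_def)
  qed
  also have "\<dots> \<le> hausdorff_outer k {x\<in>A. t (2*Suc n + p) < u x}"
    using mono by (intro hausdorff_outer_mono) (auto simp: P_def R_def)
  finally show ?case .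
qed simp

lemma tail_suminf_ennreal_tendsto_0:
  fixes f :: "nat \<Rightarrow> ennreal"
  assumes "(\<Sum>i. f i) \<noteq> top"
  shows "(\<lambda>n. \<Sum>i. f (i + n)) \<longlonglongrightarrow> 0"
proof -
  have "f i < top" for i
    using assms by (simp add: ennreal_suminf_lessD less_top)
  define r where "r i = enn2real (f i)" for i
  have r: "0 \<le> r i" "f i = ennreal (r i)" for i
    using \<open>f i < top\<close> by (simp_all add: r_def)
  have "(\<Sum>i. ennreal (r i)) \<noteq> top"
    using assms by (simp flip: r(2))
  then have sum: "summable r"
    by (rule summable_suminf_not_top[OF r(1)])
  have "(\<lambda>n. ennreal (\<Sum>i. r (i + n))) \<longlonglongrightarrow> ennreal 0"
    by (intro tendsto_ennrealI suminf_exist_split2 sum)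
  moreover have "(\<Sum>i. f (i + n)) = ennreal (\<Sum>i. r (i + n))" for n
    unfolding r(2) using r(1) sum by (intro suminf_ennreal2) (simp_all add: summable_iff_shift)
  ultimately show ?thesis
    by simp
qed

text \<open>The part of \<open>A\<close> at distance more than \<open>t n\<close> from \<open>C\<close> is separated from \<open>A \<inter> C\<close>, so the claim holds
  for this part instead of \<open>A - C\<close>. What is left of \<open>A - C\<close> is covered by rings around \<open>C\<close>, whose
  outer measures form a convergent series by the preceding estimate; so the error tends to \<open>0\<close>.\<close>

lemma hausdorff_outer_Caratheodory_closed:
  fixes C :: "'a::metric_space set"
  assumes "closed C"
  shows "hausdorff_outer k (A \<inter> C) + hausdorff_outer k (A - C) \<le> hausdorff_outer k A"
proof (cases "C = {} \<or> hausdorff_outer k A = top")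
  case True
  then show ?thesis
    by (auto simp: hausdorff_outer_empty)
next
  case False
  then have C: "C \<noteq> {}" and fin: "hausdorff_outer k A < top"
    by (auto simp: less_top)
  let ?h = "hausdorff_outer k :: 'a set \<Rightarrow> ennreal"
  define u where "u x = infdist x C" for x
  define t :: "nat \<Rightarrow> real" where "t n = 1 / (real n + 1)" for n
  define B where "B = A - C"
  define D where "D n = {x\<in>B. t n < u x}" for n
  define R where "R n = {x\<in>B. t (n + 2) < u x \<and> u x \<le> t (n + 1)}" for n
  have u: "u x - u y \<le> dist x y" for x y
    using infdist_triangle[of x C y] by (simp add: u_def)
  have t: "t (Suc n) < t n" "0 < t n" for n
    by (auto simp: t_def field_simps)
  have pos: "0 < u x" if "x \<in> B" for x
  proof -
    have "infdist x C \<noteq> 0"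
      using that in_closed_iff_infdist_zero[OF \<open>closed C\<close> C] by (simp add: B_def)
    then show ?thesis
      using infdist_nonneg[of x C] by (simp add: u_def)
  qed
  have hA: "?h S \<le> ?h A" if "S \<subseteq> B" for S
    using that by (intro hausdorff_outer_mono) (auto simp: B_def)
  \<comment> \<open>The rings of even and of odd index contribute at most \<open>?h A\<close> each.\<close>
  have "(\<Sum>i<n. ?h (R i)) \<le> 2 * ?h A" for n
  proof -
    have part: "(\<Sum>j<n. ?h (R (2*j + p))) \<le> ?h A" for p
    proof -
      have "(\<Sum>j<n. ?h (R (2*j + p))) \<le> ?h (D (2*n + p))"
        unfolding R_def D_def by (rule hausdorff_outer_rings_le[where u = u and t = t, OF u t(1)])
      also have "\<dots> \<le> ?h A"
        by (intro hA) (auto simp: D_def)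
      finally show ?thesis .
    qed
    have "(\<Sum>i<n. ?h (R i)) \<le> (\<Sum>i<2*n. ?h (R i))"
      by (intro sum_mono2) auto
    also have "\<dots> = (\<Sum>j<n. ?h (R (2*j + 0))) + (\<Sum>j<n. ?h (R (2*j + 1)))"
      by (induction n) (simp_all add: ac_simps)
    also have "\<dots> \<le> ?h A + ?h A"
      by (intro add_mono part)
    finally show ?thesis
      by (simp add: mult_2)
  qed
  then have "(\<Sum>i. ?h (R i)) \<le> 2 * ?h A"
    by (intro suminf_le_const) auto
  also have "\<dots> < top"
    using fin by (simp add: ennreal_mult_less_top)
  finally have "(\<Sum>i. ?h (R i)) \<noteq> top"
    by simp
  then have tail: "(\<lambda>n. \<Sum>i. ?h (R (i + n))) \<longlonglongrightarrow> 0"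
    by (rule tail_suminf_ennreal_tendsto_0)
  have le: "?h (A \<inter> C) + ?h B \<le> ?h A + (\<Sum>i. ?h (R (i + n)))" for n
  proof -
    have "B \<subseteq> D (Suc n) \<union> (\<Union>i. R (i + n))"
    proof
      fix x assume x: "x \<in> B"
      show "x \<in> D (Suc n) \<union> (\<Union>i. R (i + n))"
      proof (cases "t (Suc n) < u x")
        case True
        with x show ?thesis by (simp add: D_def)
      next
        case False
        obtain m where "inverse (real (Suc m)) < u x"
          using reals_Archimedean[OF pos[OF x]] by blast
        then have "t m < u x"
          by (simp add: t_def inverse_eq_divide add.commute)
        \<comment> \<open>The first threshold below \<open>u x\<close> determines the ring that contains \<open>x\<close>.\<close>
        define m' where "m' = (LEAST m. t m < u x)"
        have m': "t m' < u x"
          unfolding m'_def using \<open>t m < u x\<close> by (rule LeastI)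
        have least: "u x \<le> t i" if "i < m'" for i
          using not_less_Least[of i "\<lambda>m. t m < u x"] that by (simp add: m'_def)
        have "antimono t"
          using t(1) by (intro decseq_SucI) (simp add: less_imp_le)
        then have "m' > Suc n"
          using m' False antimonoD[of t m' "Suc n"] by linarith
        then obtain i where "m' = i + n + 2"
          using that[of "m' - n - 2"] by simp
        then have "x \<in> R (i + n)"
          using m' least[of "i + n + 1"] x by (simp add: R_def)
        then show ?thesis by blast
      qed
    qed
    then have "?h B \<le> ?h (D (Suc n) \<union> (\<Union>i. R (i + n)))"
      by (rule hausdorff_outer_mono)
    also have "\<dots> \<le> ?h (D (Suc n)) + (\<Sum>i. ?h (R (i + n)))"
      by (intro order_trans[OF hausdorff_outer_Un_le] add_left_mono hausdorff_outer_UN_le)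
    finally have "?h (A \<inter> C) + ?h B \<le> ?h (A \<inter> C) + ?h (D (Suc n)) + (\<Sum>i. ?h (R (i + n)))"
      by (simp add: add.assoc add_left_mono)
    also have "?h (A \<inter> C) + ?h (D (Suc n)) \<le> ?h (A \<inter> C \<union> D (Suc n))"
    proof (rule hausdorff_outer_separated)
      fix x y assume "x \<in> A \<inter> C" "y \<in> D (Suc n)"
      then show "t (Suc n) \<le> dist x y"
        using u[of y x] by (auto simp: D_def u_def dist_commute)
    qed (rule t)
    also have "\<dots> \<le> ?h A"
      by (intro hausdorff_outer_mono) (auto simp: D_def B_def)
    finally show ?thesis
      by (simp add: add_right_mono)
  qed
  have "(\<lambda>n. ?h A + (\<Sum>i. ?h (R (i + n)))) \<longlonglongrightarrow> ?h A + 0"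
    using tail by (intro tendsto_add tendsto_const)
  then have "?h (A \<inter> C) + ?h B \<le> ?h A + 0"
    by (rule LIMSEQ_le_const) (intro exI allI impI le)
  then show ?thesis
    by (simp add: B_def)
qed

lemma borel_subset_lambda_system_hausdorff:
  "sets borel \<subseteq> lambda_system UNIV (Pow UNIV) (hausdorff_outer k :: 'a::metric_space set \<Rightarrow> ennreal)"
  (is "_ \<subseteq> ?L")
proof -
  have "measure_space UNIV ?L (hausdorff_outer k)"
    by (rule sigma_algebra.caratheodory_lemma[OF sigma_algebra_Pow outer_measure_space_hausdorff])
  then interpret sigma_algebra UNIV ?L
    by (simp add: measure_space_def)
  have "C \<in> ?L" if "closed C" for C
  proof -
    have "hausdorff_outer k (C \<inter> A) + hausdorff_outer k ((UNIV - C) \<inter> A) = hausdorff_outer k A" for A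
    proof (rule antisym)
      show "hausdorff_outer k (C \<inter> A) + hausdorff_outer k ((UNIV - C) \<inter> A) \<le> hausdorff_outer k A"
        using hausdorff_outer_Caratheodory_closed[OF that, of k A]
        by (simp add: Int_commute Diff_eq)
      have "A = (C \<inter> A) \<union> ((UNIV - C) \<inter> A)"
        by auto
      then show "hausdorff_outer k A \<le> hausdorff_outer k (C \<inter> A) + hausdorff_outer k ((UNIV - C) \<inter> A)"
        by (metis hausdorff_outer_Un_le)
    qed
    then show ?thesis
      by (auto simp: lambda_system_def)
  qed
  then have "sigma_sets UNIV (Collect closed) \<subseteq> ?L"
    by (intro sigma_sets_subset subsetI) simp
  then show ?thesis
    unfolding borel_eq_closed by (simp only: sets_measure_of[OF subset_UNIV[of "Collect closed", folded Pow_UNIV]])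
qed

theorem emeasure_hausdorff_measure:
  assumes "A \<in> sets borel"
  shows "emeasure (hausdorff_measure k) A = hausdorff_outer k A"
proof -
  have "measure_space UNIV (sets borel) (hausdorff_outer k :: 'a set \<Rightarrow> ennreal)"
    by (rule measure_down[OF sigma_algebra.caratheodory_lemma[OF sigma_algebra_Pow
          outer_measure_space_hausdorff] _ borel_subset_lambda_system_hausdorff])
      (metis sets.sigma_algebra_axioms space_borel)
  then show ?thesis
    using assms unfolding hausdorff_measure_def
    by (intro emeasure_measure_of_sigma) (auto simp: measure_space_def)
qed

lemma sets_hausdorff_measure [simp, measurable_cong]: "sets (hausdorff_measure k) = sets borel"
  unfolding hausdorff_measure_def by (metis sets.sets_measure_of_eq space_borel)

lemma space_hausdorff_measure [simp]: "space (hausdorff_measure k) = UNIV"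
  unfolding hausdorff_measure_def by (rule space_measure_of_conv)

lemma emeasure_hausdorff_measure_translation:
  fixes A :: "'a::euclidean_space set"
  assumes "A \<in> sets borel"
  shows "emeasure (hausdorff_measure k) ((\<lambda>x. x - a) -` A) = emeasure (hausdorff_measure k) A"
proof -
  have eq: "(\<lambda>x. x - a) -` A = (+) a ` A"
    by (force simp: image_iff)
  have "(\<lambda>x. x - a) -` A \<in> sets borel"
    using measurable_sets_borel[of "\<lambda>x. x - a" borel A] assms by simp
  then show ?thesis
    using assms hausdorff_outer_isometric_image[of "(+) a" k A]
    by (simp add: emeasure_hausdorff_measure eq)
qed

section \<open>Hausdorff measure of full dimension is a multiple of Lebesgue measure\<close>

text \<open>Covers in the definition of the premeasure are sequences; a finite family is padded with empty
  sets, whose gauge is \<open>0\<close>.\<close>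

lemma hausdorff_premeasure_finite_cover_le:
  assumes "finite I" "A \<subseteq> (\<Union>i\<in>I. q i)" "\<And>i. i \<in> I \<Longrightarrow> bounded (q i)"
    "\<And>i. i \<in> I \<Longrightarrow> diameter (q i) \<le> \<delta>" "0 \<le> \<delta>"
  shows "hausdorff_premeasure k \<delta> A \<le> (\<Sum>i\<in>I. hausdorff_gauge k (q i))"
proof -
  obtain h where h: "bij_betw h {0..<card I} I"
    using ex_bij_betw_nat_finite[OF assms(1)] by blast
  have hI: "h n \<in> I" if "n < card I" for n
    using bij_betwE[OF h] that by simp
  define U where "U n = (if n < card I then q (h n) else {})" for n
  have "hausdorff_premeasure k \<delta> A \<le> (\<Sum>n. hausdorff_gauge k (U n))"
  proof (rule hausdorff_premeasure_le)
    have "q i \<subseteq> (\<Union>n. U n)" if "i \<in> I" for i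
    proof -
      have "i \<in> h ` {0..<card I}"
        using that by (simp add: bij_betw_imp_surj_on[OF h])
      then obtain n where "n < card I" "h n = i"
        by auto
      then have "q i = U n"
        by (simp add: U_def)
      then show ?thesis by auto
    qed
    then show "A \<subseteq> (\<Union>n. U n)"
      by (rule order_trans[OF assms(2) UN_least])
    show "bounded (U n)" for n
      by (simp add: U_def hI assms(3))
    show "diameter (U n) \<le> \<delta>" for n
      by (simp add: U_def hI assms(4) \<open>0 \<le> \<delta>\<close>)
  qed
  also have "\<dots> = (\<Sum>n\<in>{0..<card I}. hausdorff_gauge k (U n))"
    by (rule suminf_finite) (simp_all add: U_def)
  also have "\<dots> = (\<Sum>n\<in>{0..<card I}. hausdorff_gauge k (q (h n)))"
    by (rule sum.cong) (simp_all add: U_def)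
  also have "\<dots> = (\<Sum>i\<in>I. hausdorff_gauge k (q i))"
    by (rule sum.reindex_bij_betw[OF h])
  finally show ?thesis .
qed

text \<open>The unit cube of dimension \<open>k\<close> is covered by \<open>(n + 1) ^ k\<close> cubes of side \<open>1 / n\<close>, each of
  diameter at most \<open>k / n\<close>, and the resulting bound \<open>c\<close> does not depend on \<open>n\<close>.\<close>

lemma hausdorff_outer_cube_less_top:
  "hausdorff_outer DIM('a) (cbox 0 (One :: 'a::euclidean_space)) < top"
proof -
  define k where "k = DIM('a)"
  define c where "c = unit_ball_vol (real k) * real k ^ k"
  have "hausdorff_outer k (cbox 0 (One :: 'a)) \<le> ennreal c"
  proof (rule hausdorff_outer_least)
    fix \<delta> :: real assume "0 < \<delta>"
    obtain n :: nat where n: "real k / \<delta> < real n"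
      using reals_Archimedean2 by blast
    have "0 < real k / \<delta>"
      using \<open>0 < \<delta>\<close> by (simp add: k_def)
    with n have "n > 0"
      by linarith
    \<comment> \<open>A map \<open>f \<in> I\<close> lists the integer coordinates of the lower corner of a grid cell \<open>q f\<close>.\<close>
    define I where "I = (Basis :: 'a set) \<rightarrow>\<^sub>E {..n}"
    define q where "q f = cbox (\<Sum>b\<in>Basis. (real (f b) / n) *\<^sub>R b) (\<Sum>b\<in>Basis. (real (f b + 1) / n) *\<^sub>R b)"
      for f :: "'a \<Rightarrow> nat"
    have memq: "x \<in> q f \<longleftrightarrow> (\<forall>b\<in>Basis. real (f b) / n \<le> x \<bullet> b \<and> x \<bullet> b \<le> real (f b) / n + 1 / n)" for x f
      by (simp add: q_def mem_box add_divide_distrib add.commute)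
    have dq: "dist x y \<le> k / n" if "x \<in> q f" "y \<in> q f" for x y f
    proof -
      have "dist x y \<le> (\<Sum>b\<in>Basis. \<bar>(x - y) \<bullet> b\<bar>)"
        unfolding dist_norm by (rule norm_le_l1)
      also have "\<dots> \<le> (\<Sum>b\<in>(Basis :: 'a set). 1 / n)"
      proof (rule sum_mono)
        fix b :: 'a assume "b \<in> Basis"
        then show "\<bar>(x - y) \<bullet> b\<bar> \<le> 1 / n"
          using that unfolding memq inner_diff_left by (fastforce simp: abs_le_iff)
      qed
      finally show ?thesis
        by (simp add: k_def)
    qed
    have q: "bounded (q f)" "diameter (q f) \<le> k / n" for f
    proof -
      show "bounded (q f)"
        by (simp add: q_def)
      show "diameter (q f) \<le> k / n"
        using dq by (intro diameter_le) (auto simp: dist_norm)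
    qed
    have "k / n \<le> \<delta>"
      using n \<open>0 < \<delta>\<close> \<open>n > 0\<close> by (simp add: field_simps)
    have "hausdorff_premeasure k \<delta> (cbox 0 (One :: 'a)) \<le> (\<Sum>f\<in>I. hausdorff_gauge k (q f))"
    proof (rule hausdorff_premeasure_finite_cover_le)
      show "cbox 0 (One :: 'a) \<subseteq> (\<Union>f\<in>I. q f)"
      proof
        fix x :: 'a assume x: "x \<in> cbox 0 One"
        define f where "f = (\<lambda>b\<in>Basis. nat \<lfloor>(x \<bullet> b) * n\<rfloor>)"
        have x01: "0 \<le> x \<bullet> b" "x \<bullet> b \<le> 1" if "b \<in> Basis" for b
          using x that by (auto simp: mem_box)
        have "f \<in> I"
        proof -
          have "nat \<lfloor>(x \<bullet> b) * n\<rfloor> \<le> n" if "b \<in> Basis" for b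
          proof -
            have "(x \<bullet> b) * real n \<le> 1 * real n"
              using x01[OF that] by (intro mult_right_mono) auto
            then show ?thesis by linarith
          qed
          then show ?thesis by (auto simp: I_def f_def)
        qed
        moreover have "x \<in> q f"
          unfolding memq
        proof
          fix b :: 'a assume b: "b \<in> Basis"
          have "0 \<le> (x \<bullet> b) * n"
            using x01[OF b] by simp
          then have "real (f b) \<le> (x \<bullet> b) * n" "(x \<bullet> b) * n \<le> real (f b) + 1"
            using b unfolding f_def by (auto simp: of_nat_nat)
          then show "real (f b) / n \<le> x \<bullet> b \<and> x \<bullet> b \<le> real (f b) / n + 1 / n"
            using \<open>n > 0\<close> by (simp add: field_simps)
        qed
        ultimately show "x \<in> (\<Union>f\<in>I. q f)" by blast
      qed
    next
      fix f
      show "diameter (q f) \<le> \<delta>"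
        using q(2)[of f] \<open>k / n \<le> \<delta>\<close> by linarith
    qed (use q \<open>0 < \<delta>\<close> in \<open>auto simp: I_def intro!: finite_PiE\<close>)
    also have "\<dots> \<le> (\<Sum>f\<in>I. ennreal (unit_ball_vol (real k) * (real k / n / 2) ^ k))"
      using q diameter_ge_0[OF q(1)]
      by (intro sum_mono) (auto simp: hausdorff_gauge_def intro!: ennreal_leI mult_left_mono power_mono)
    also have "\<dots> = ennreal (real ((n + 1) ^ k) * (unit_ball_vol (real k) * (real k / n / 2) ^ k))"
      by (simp add: I_def card_PiE k_def ennreal_of_nat_eq_real_of_nat flip: ennreal_mult)
    also have "\<dots> \<le> ennreal c"
    proof (rule ennreal_leI)
      have "1 \<le> real n"
        using \<open>n > 0\<close> by linarith
      then have "real (n + 1) / (2 * real n) \<le> 1"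
        by (simp add: divide_le_eq)
      then have "real k * (real (n + 1) / (2 * real n)) \<le> real k * 1"
        by (rule mult_left_mono) simp
      then have "real (n + 1) * (real k / n / 2) \<le> real k"
        by (simp add: mult.commute)
      then have "(real (n + 1) * (real k / n / 2)) ^ k \<le> real k ^ k"
        by (intro power_mono) auto
      then have "unit_ball_vol (real k) * (real (n + 1) * (real k / n / 2)) ^ k \<le> c"
        unfolding c_def by (intro mult_left_mono) auto
      then show "real ((n + 1) ^ k) * (unit_ball_vol (real k) * (real k / n / 2) ^ k) \<le> c"
        by (simp only: power_mult_distrib of_nat_power mult.left_commute)
    qed
    finally show "hausdorff_premeasure k \<delta> (cbox 0 (One :: 'a)) \<le> ennreal c" .
  qed
  then show ?thesis
    unfolding k_def by (rule le_less_trans) simp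
qed

text \<open>Uniqueness of translation invariant measures by Fubini's theorem: with \<open>H\<close> the Hausdorff measure,
  \<open>\<lambda>\<close> the Lebesgue measure and \<open>Q\<close> the unit cube, the \<open>H \<times> \<lambda>\<close>-measure of
  \<open>{(x, y). x \<in> A \<and> x + y \<in> Q}\<close> is computed in both orders. Integrating over \<open>y\<close> first gives
  \<open>H A * \<lambda> Q\<close>. Translating \<open>x\<close> by \<open>y\<close> turns the set into \<open>{(x, y). x - y \<in> A \<and> x \<in> Q}\<close>, which
  gives \<open>H Q * \<lambda> A\<close> because \<open>\<lambda>\<close> is also invariant under reflections.\<close>

theorem hausdorff_measure_eq_lborel:
  fixes A :: "'a::euclidean_space set"
  assumes A: "A \<in> sets borel"
  shows "emeasure (hausdorff_measure DIM('a)) A =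
           emeasure (hausdorff_measure DIM('a)) (cbox 0 (One :: 'a)) * emeasure lborel A"
proof -
  let ?H = "hausdorff_measure DIM('a) :: 'a measure"
  let ?Q = "cbox 0 (One :: 'a)"
  note trans = emeasure_hausdorff_measure_translation
  have "emeasure ?H ?Q < top"
    by (simp add: emeasure_hausdorff_measure hausdorff_outer_cube_less_top)
  then interpret H: sigma_finite_measure ?H
  proof (unfold_locales, goal_cases)
    case 1
    \<comment> \<open>Countably many translates of the cube, by the points of a dense set, cover the whole space.\<close>
    obtain D :: "'a set" where D: "countable D" "\<And>X. open X \<Longrightarrow> X \<noteq> {} \<Longrightarrow> \<exists>d\<in>D. d \<in> X"
      using countable_dense_exists by blast
    have "x \<in> (\<Union>d\<in>D. (\<lambda>x. x - d) -` ?Q)" for x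
    proof -
      have "(1/2) *\<^sub>R (One :: 'a) \<in> box 0 One"
        by (simp add: mem_box)
      then have "x - (1/2) *\<^sub>R One \<in> (\<lambda>d. x - d) -` box 0 One"
        by simp
      then have "(\<lambda>d. x - d) -` box 0 One \<noteq> {}"
        by blast
      moreover have "open ((\<lambda>d. x - d) -` box 0 One)"
        by (intro open_vimage continuous_intros) auto
      ultimately obtain d where "d \<in> D" "d \<in> (\<lambda>d. x - d) -` box 0 One"
        using D(2) by meson
      then have "x \<in> (\<lambda>x. x - d) -` ?Q"
        using box_subset_cbox[of 0 One] by auto
      with \<open>d \<in> D\<close> show ?thesis
        by (rule UN_I)
    qed
    then have "(\<Union>d\<in>D. (\<lambda>x. x - d) -` ?Q) = UNIV"
      by blast
    moreover have "(\<lambda>x. x - d) -` ?Q \<in> sets ?H" for d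
      using measurable_sets_borel[of "\<lambda>x. x - d" borel ?Q] by simp
    moreover have "emeasure ?H ((\<lambda>x. x - d) -` ?Q) \<noteq> \<infinity>" for d
      using 1 trans[of ?Q] by simp
    ultimately show ?case
      using D(1) by (intro exI[of _ "(\<lambda>d. (\<lambda>x. x - d) -` ?Q) ` D"]) auto
  qed
  interpret pair_sigma_finite ?H "lborel :: 'a measure" ..
  have [measurable]: "A \<in> sets borel" "?Q \<in> sets borel"
    using A by auto
  have lb: "emeasure lborel ((\<lambda>y. x + y) -` ?Q) = emeasure lborel ?Q"
    "emeasure lborel ((\<lambda>y. x - y) -` A) = emeasure lborel A" for x :: 'a
  proof -
    have refl: "distr lborel borel (\<lambda>y. x + c *\<^sub>R y) = lborel" if "\<bar>c\<bar> = 1" for c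
      using lborel_affine[of c x] that by (simp add: density_1)
    show "emeasure lborel ((\<lambda>y. x + y) -` ?Q) = emeasure lborel ?Q"
      using emeasure_distr[of "\<lambda>y. x + 1 *\<^sub>R y" lborel borel ?Q] refl[of 1] by simp
    show "emeasure lborel ((\<lambda>y. x - y) -` A) = emeasure lborel A"
      using emeasure_distr[of "\<lambda>y. x + (-1) *\<^sub>R y" lborel borel A] refl[of "-1"] by simp
  qed
  have "emeasure ?H A * emeasure lborel ?Q = (\<integral>\<^sup>+x. indicator A x * emeasure lborel ((\<lambda>y. x + y) -` ?Q) \<partial>?H)"
    by (simp add: lb nn_integral_multc)
  also have "\<dots> = (\<integral>\<^sup>+x. (\<integral>\<^sup>+y. indicator A x * indicator ?Q (x + y) \<partial>lborel) \<partial>?H)"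
  proof (rule nn_integral_cong)
    fix x
    have "(\<integral>\<^sup>+y. indicator ?Q (x + y) \<partial>lborel) = (\<integral>\<^sup>+y. indicator ((\<lambda>y. x + y) -` ?Q) y \<partial>lborel)"
      by (intro nn_integral_cong) (simp add: indicator_def)
    also have "\<dots> = emeasure lborel ((\<lambda>y. x + y) -` ?Q)"
      using measurable_sets_borel[of "\<lambda>y. x + y" borel ?Q] by (intro nn_integral_indicator) simp
    finally show "indicator A x * emeasure lborel ((\<lambda>y. x + y) -` ?Q) =
        (\<integral>\<^sup>+y. indicator A x * indicator ?Q (x + y) \<partial>lborel)"
      by (simp add: nn_integral_cmult)
  qed
  also have "\<dots> = (\<integral>\<^sup>+y. (\<integral>\<^sup>+x. indicator A x * indicator ?Q (x + y) \<partial>?H) \<partial>lborel)"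
    by (rule Fubini'[symmetric]) measurable
  also have "\<dots> = (\<integral>\<^sup>+y. (\<integral>\<^sup>+x. indicator A (x - y) * indicator ?Q x \<partial>?H) \<partial>lborel)"
  proof (rule nn_integral_cong)
    fix y :: 'a
    \<comment> \<open>For fixed \<open>y\<close> the section of the set in the \<open>x\<close>-direction is translated by \<open>y\<close>.\<close>
    define S where "S = A \<inter> (\<lambda>x. x + y) -` ?Q"
    have S: "S \<in> sets borel" "(\<lambda>x. x - y) -` S \<in> sets borel"
      using measurable_sets_borel[of "\<lambda>x. x + y" borel ?Q] measurable_sets_borel[of "\<lambda>x. x - y" borel S] A
      unfolding S_def by auto
    have "(\<integral>\<^sup>+x. indicator A x * indicator ?Q (x + y) \<partial>?H) = (\<integral>\<^sup>+x. indicator S x \<partial>?H)"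
      by (intro nn_integral_cong) (auto simp: S_def indicator_def)
    also have "\<dots> = (\<integral>\<^sup>+x. indicator ((\<lambda>x. x - y) -` S) x \<partial>?H)"
      using S by (simp add: trans)
    also have "\<dots> = (\<integral>\<^sup>+x. indicator A (x - y) * indicator ?Q x \<partial>?H)"
      by (intro nn_integral_cong) (auto simp: S_def indicator_def)
    finally show "(\<integral>\<^sup>+x. indicator A x * indicator ?Q (x + y) \<partial>?H) =
        (\<integral>\<^sup>+x. indicator A (x - y) * indicator ?Q x \<partial>?H)" .
  qed
  also have "\<dots> = (\<integral>\<^sup>+x. (\<integral>\<^sup>+y. indicator A (x - y) * indicator ?Q x \<partial>lborel) \<partial>?H)"
    by (rule Fubini') measurable
  also have "\<dots> = (\<integral>\<^sup>+x. indicator ?Q x * emeasure lborel ((\<lambda>y. x - y) -` A) \<partial>?H)"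
  proof (rule nn_integral_cong)
    fix x
    have "(\<integral>\<^sup>+y. indicator A (x - y) \<partial>lborel) = (\<integral>\<^sup>+y. indicator ((\<lambda>y. x - y) -` A) y \<partial>lborel)"
      by (intro nn_integral_cong) (simp add: indicator_def)
    also have "\<dots> = emeasure lborel ((\<lambda>y. x - y) -` A)"
      using measurable_sets_borel[of "\<lambda>y. x - y" borel A] A by (intro nn_integral_indicator) simp
    finally show "(\<integral>\<^sup>+y. indicator A (x - y) * indicator ?Q x \<partial>lborel) =
        indicator ?Q x * emeasure lborel ((\<lambda>y. x - y) -` A)"
      by (simp add: nn_integral_multc mult.commute)
  qed
  also have "\<dots> = emeasure ?H ?Q * emeasure lborel A"
    by (simp add: lb nn_integral_multc)
  finally show ?thesis
    by (simp add: emeasure_lborel_cbox_eq)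
qed

section \<open>Simplices, tangent spaces and tangential gradients\<close>

lemma affine_hull_eq_translate_tangent_space:
  assumes "p \<in> \<sigma>"
  shows "affine hull \<sigma> = (+) p ` tangent_space \<sigma>"
proof -
  have "{x - y | x y. x \<in> \<sigma> \<and> y \<in> \<sigma>} \<subseteq> span ((\<lambda>x. - p + x) ` \<sigma>)"
  proof safe
    fix x y assume "x \<in> \<sigma>" "y \<in> \<sigma>"
    then have "(- p + x) - (- p + y) \<in> span ((\<lambda>x. - p + x) ` \<sigma>)"
      by (intro span_diff span_base imageI)
    then show "x - y \<in> span ((\<lambda>x. - p + x) ` \<sigma>)"
      by simp
  qed
  moreover have "(\<lambda>x. - p + x) ` \<sigma> \<subseteq> {x - y | x y. x \<in> \<sigma> \<and> y \<in> \<sigma>}"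
  proof safe
    fix x assume "x \<in> \<sigma>"
    then show "\<exists>x' y. - p + x = x' - y \<and> x' \<in> \<sigma> \<and> y \<in> \<sigma>"
      using assms by (intro exI[of _ x] exI[of _ p]) simp
  qed
  ultimately have "tangent_space \<sigma> = span ((\<lambda>x. - p + x) ` \<sigma>)"
    by (simp add: tangent_space_def span_eq subset_trans[OF _ span_superset])
  moreover have "affine hull \<sigma> = (+) p ` span ((\<lambda>x. - p + x) ` \<sigma>)"
    by (rule affine_hull_span_gen) (simp add: assms hull_inc)
  ultimately show ?thesis
    by simp
qed

lemma subspace_tangent_space: "subspace (tangent_space \<sigma>)"
  by (simp add: tangent_space_def)

lemma affine_hull_diff_in_tangent_space:
  assumes "x \<in> affine hull \<sigma>" "y \<in> affine hull \<sigma>"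
  shows "x - y \<in> tangent_space \<sigma>"
proof -
  obtain p where "p \<in> \<sigma>"
    using assms(1) affine_hull_empty by (metis ex_in_conv)
  then have "x \<in> (+) p ` tangent_space \<sigma>" "y \<in> (+) p ` tangent_space \<sigma>"
    using assms by (simp_all add: affine_hull_eq_translate_tangent_space)
  then obtain s t where "s \<in> tangent_space \<sigma>" "t \<in> tangent_space \<sigma>" "x = p + s" "y = p + t"
    by (auto simp del: add_diff_cancel)
  then show ?thesis
    by (simp add: subspace_diff subspace_tangent_space)
qed

lemma affine_hull_plus_tangent_space:
  assumes "x \<in> affine hull \<sigma>" "t \<in> tangent_space \<sigma>"
  shows "x + t \<in> affine hull \<sigma>"
proof -
  obtain p where p: "p \<in> \<sigma>"
    using assms(1) affine_hull_empty by (metis ex_in_conv)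
  have hull: "affine hull \<sigma> = (+) p ` tangent_space \<sigma>"
    by (rule affine_hull_eq_translate_tangent_space[OF p])
  then obtain s where s: "s \<in> tangent_space \<sigma>" "x = p + s"
    using assms(1) by auto
  have "s + t \<in> tangent_space \<sigma>"
    by (rule subspace_add[OF subspace_tangent_space s(1) assms(2)])
  then show ?thesis
    unfolding hull s(2) add.assoc by (rule imageI)
qed

lemma dim_tangent_space:
  assumes "\<not> affine_dependent \<sigma>" "\<sigma> \<noteq> {}"
  shows "dim (tangent_space \<sigma>) = card \<sigma> - 1"
proof -
  obtain p where p: "p \<in> \<sigma>"
    using assms(2) by blast
  have "aff_dim \<sigma> = aff_dim ((+) p ` tangent_space \<sigma>)"
    by (metis aff_dim_affine_hull affine_hull_eq_translate_tangent_space[OF p])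
  also have "\<dots> = aff_dim (tangent_space \<sigma>)"
    by (rule aff_dim_translation_eq)
  also have "\<dots> = int (dim (tangent_space \<sigma>))"
    by (rule aff_dim_subspace[OF subspace_tangent_space])
  finally show ?thesis
    using aff_dim_affine_independent[OF assms(1)] by simp
qed

lemma open_simplex_subset: "open_simplex \<sigma> \<subseteq> convex hull \<sigma>" "open_simplex \<sigma> \<subseteq> affine hull \<sigma>"
  unfolding open_simplex_def using rel_interior_subset convex_hull_subset_affine_hull by blast+

lemma open_simplex_borel: "open_simplex \<sigma> \<in> sets borel"
proof -
  have "openin (top_of_set (affine hull (convex hull \<sigma>))) (open_simplex \<sigma>)"
    unfolding open_simplex_def by (rule openin_rel_interior)
  then obtain U where "open U" "open_simplex \<sigma> = affine hull (convex hull \<sigma>) \<inter> U"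
    unfolding openin_open by blast
  then show ?thesis
    by (simp add: borel_closed)
qed

lemma open_simplex_line_segment:
  assumes "x \<in> open_simplex \<sigma>" "t \<in> tangent_space \<sigma>"
  obtains e where "0 < e" "\<And>s. \<bar>s\<bar> < e \<Longrightarrow> x + s *\<^sub>R t \<in> open_simplex \<sigma>"
proof -
  have "rel_interior (open_simplex \<sigma>) = open_simplex \<sigma>"
    by (simp add: open_simplex_def rel_interior_rel_interior)
  moreover have hull: "affine hull (open_simplex \<sigma>) = affine hull \<sigma>"
    by (simp add: open_simplex_def rel_interior_same_affine_hull)
  ultimately obtain d where d: "0 < d" "ball x d \<inter> affine hull \<sigma> \<subseteq> open_simplex \<sigma>"
    using assms(1) mem_rel_interior_ball[of x "open_simplex \<sigma>"] by auto
  show thesis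
  proof
    show "0 < d / (norm t + 1)"
      using d(1) by (intro divide_pos_pos) (auto intro: add_nonneg_pos)
    fix s :: real assume s: "\<bar>s\<bar> < d / (norm t + 1)"
    have n: "0 < norm t + 1"
      by (intro add_nonneg_pos) auto
    have "\<bar>s\<bar> * norm t \<le> \<bar>s\<bar> * (norm t + 1)"
      by (intro mult_left_mono) auto
    also have "\<dots> < d"
      using s n by (simp add: pos_less_divide_eq)
    finally have "x + s *\<^sub>R t \<in> ball x d"
      by (simp add: dist_norm)
    moreover have "x + s *\<^sub>R t \<in> affine hull \<sigma>"
      using assms open_simplex_subset(2)
      by (intro affine_hull_plus_tangent_space subspace_scale[OF subspace_tangent_space]) auto
    ultimately show "x + s *\<^sub>R t \<in> open_simplex \<sigma>"
      using d(2) by blast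
  qed
qed

text \<open>A derivative within the lower-dimensional set \<open>open_simplex \<sigma>\<close> determines the vector \<open>g\<close> only up to
  the normal directions. In a tangential direction it is determined, because a short segment through
  \<open>x\<close> in this direction stays in the open simplex and \<open>f\<close> can be differentiated along it.\<close>

lemma tangential_derivative_unique:
  assumes x: "x \<in> open_simplex \<sigma>" and t: "t \<in> tangent_space \<sigma>"
    and f: "(f has_derivative (\<lambda>h. g \<bullet> h)) (at x within open_simplex \<sigma>)"
           "(f has_derivative (\<lambda>h. g' \<bullet> h)) (at x within open_simplex \<sigma>)"
  shows "g \<bullet> t = g' \<bullet> t"
proof -
  obtain e where e: "0 < e" "\<And>s. \<bar>s\<bar> < e \<Longrightarrow> x + s *\<^sub>R t \<in> open_simplex \<sigma>"
    using open_simplex_line_segment[OF x t] by blast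
  define \<phi> where "\<phi> s = x + s *\<^sub>R t" for s
  have \<phi>: "(\<phi> has_derivative (\<lambda>s. s *\<^sub>R t)) (at 0 within ball 0 e)"
    unfolding \<phi>_def by (auto intro!: derivative_eq_intros)
  have sub: "\<phi> ` ball 0 e \<subseteq> open_simplex \<sigma>"
    using e(2) by (auto simp: \<phi>_def)
  have line: "((\<lambda>s. f (\<phi> s)) has_derivative (\<lambda>s. a \<bullet> (s *\<^sub>R t))) (at 0)"
    if "(f has_derivative (\<lambda>h. a \<bullet> h)) (at x within open_simplex \<sigma>)" for a
  proof -
    have "\<phi> 0 = x"
      by (simp add: \<phi>_def)
    then have "(f has_derivative (\<lambda>h. a \<bullet> h)) (at (\<phi> 0) within \<phi> ` ball 0 e)"
      using has_derivative_subset[OF that sub] by simp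
    from has_derivative_in_compose[OF \<phi> this]
    have "((\<lambda>s. f (\<phi> s)) has_derivative (\<lambda>s. a \<bullet> (s *\<^sub>R t))) (at 0 within ball 0 e)" .
    then show ?thesis
      using e(1) by (simp add: at_within_open[of 0 "ball 0 e"])
  qed
  have "(\<lambda>s. g \<bullet> (s *\<^sub>R t)) = (\<lambda>s. g' \<bullet> (s *\<^sub>R t))"
    by (rule has_derivative_unique[OF line[OF f(1)] line[OF f(2)]])
  from fun_cong[OF this, of 1] show ?thesis
    by simp
qed

text \<open>The tangential gradient of an affine function is the orthogonal projection of the full gradient \<open>a\<close>
  to the tangent space, which is expressed here by its inner products with tangent vectors.\<close>

lemma tangential_gradient_affine:
  assumes x: "x \<in> open_simplex \<sigma>" and f: "\<And>y. y \<in> convex hull \<sigma> \<Longrightarrow> f y = a \<bullet> y + b"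
  shows "tangential_gradient \<sigma> f x \<in> tangent_space \<sigma>"
    and "t \<in> tangent_space \<sigma> \<Longrightarrow> tangential_gradient \<sigma> f x \<bullet> t = a \<bullet> t"
proof -
  let ?V = "tangent_space \<sigma>" and ?S = "open_simplex \<sigma>"
  let ?P = "\<lambda>g. g \<in> ?V \<and> (f has_derivative (\<lambda>h. g \<bullet> h)) (at x within ?S)"
  have span: "span ?V = ?V"
    by (rule span_eq_iff[THEN iffD2, OF subspace_tangent_space])
  obtain g z where g: "g \<in> ?V" "\<And>t. t \<in> ?V \<Longrightarrow> z \<bullet> t = 0" "a = g + z"
  proof (rule orthogonal_subspace_decomp_exists[of ?V a])
    fix y z assume "y \<in> span ?V" "\<And>w. w \<in> span ?V \<Longrightarrow> orthogonal z w" "a = y + z"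
    then show thesis
      using that[of y z] by (simp add: span orthogonal_def)
  qed
  have gt: "g \<bullet> t = a \<bullet> t" if "t \<in> ?V" for t
    using g(2)[OF that] g(3) by (simp add: inner_add_left)
  have "f y = g \<bullet> y + (a \<bullet> x - g \<bullet> x + b)" if "y \<in> ?S" for y
  proof -
    have "y - x \<in> ?V"
      by (rule affine_hull_diff_in_tangent_space[OF subsetD[OF open_simplex_subset(2) that]
            subsetD[OF open_simplex_subset(2) x]])
    moreover have "f y = a \<bullet> y + b"
      by (rule f[OF subsetD[OF open_simplex_subset(1) that]])
    ultimately show ?thesis
      using gt[of "y - x"] by (simp add: inner_diff_right)
  qed
  note eq = this
  have deriv: "((\<lambda>y. g \<bullet> y + (a \<bullet> x - g \<bullet> x + b)) has_derivative (\<lambda>h. g \<bullet> h)) (at x within ?S)"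
    by (auto intro!: derivative_eq_intros)
  have g_deriv: "(f has_derivative (\<lambda>h. g \<bullet> h)) (at x within ?S)"
    by (rule has_derivative_transform[OF x eq deriv])
  have "g' = g" if "?P g'" for g'
  proof -
    have "g' - g \<in> ?V"
      using that g(1) by (simp add: subspace_diff subspace_tangent_space)
    then have "g' \<bullet> (g' - g) = g \<bullet> (g' - g)"
      using that g_deriv by (intro tangential_derivative_unique[OF x]) simp_all
    then have "(g' - g) \<bullet> (g' - g) = 0"
      by (simp add: inner_diff_left)
    then show ?thesis
      by simp
  qed
  then have "tangential_gradient \<sigma> f x = g"
    unfolding tangential_gradient_def by (intro the_equality conjI g(1) g_deriv)
  then show "tangential_gradient \<sigma> f x \<in> ?V" "t \<in> ?V \<Longrightarrow> tangential_gradient \<sigma> f x \<bullet> t = a \<bullet> t"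
    using g(1) gt by auto
qed

lemma linear_isometry_inner:
  assumes "linear F" "\<And>x. norm (F x) = norm x"
  shows "F x \<bullet> F y = x \<bullet> y"
  by (simp only: dot_norm linear_add[OF assms(1), symmetric] assms(2))

text \<open>The Frobenius product of the gradients, read off in the orthonormal basis of the tangent space that
  the isometry \<open>F\<close> provides. The tangential gradients of the components of \<open>u\<close> are the rows of the
  linear part \<open>A\<close>, restricted to the tangent space; summing over columns instead of rows gives the
  formula.\<close>

lemma gradient_product_affine:
  fixes F :: "'e::euclidean_space \<Rightarrow> real ^ 'd"
  assumes x: "x \<in> open_simplex \<sigma>"
    and F: "\<And>x y. F x \<bullet> F y = x \<bullet> y" "range F = tangent_space \<sigma>"
    and u: "linear A" "\<And>y. y \<in> convex hull \<sigma> \<Longrightarrow> u y = A y + b"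
    and w: "linear B" "\<And>y. y \<in> convex hull \<sigma> \<Longrightarrow> w y = B y + c"
  shows "gradient_product \<sigma> u w x = (\<Sum>e\<in>Basis. A (F e) \<bullet> B (F e))"
proof -
  have comp: "tangential_gradient \<sigma> (\<lambda>y. u y $ i) x \<in> tangent_space \<sigma> \<and>
      (\<forall>t\<in>tangent_space \<sigma>. tangential_gradient \<sigma> (\<lambda>y. u y $ i) x \<bullet> t = A t $ i)"
    if lin: "linear A" and A: "\<And>y. y \<in> convex hull \<sigma> \<Longrightarrow> u y = A y + b" for u A b i
  proof -
    define a where "a = adjoint A (axis i 1)"
    have a: "A y $ i = a \<bullet> y" for y
      using adjoint_works[OF lin, of y "axis i 1"] by (simp add: a_def inner_axis inner_commute)
    have "u y $ i = a \<bullet> y + b $ i" if "y \<in> convex hull \<sigma>" for y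
      using A[OF that] by (simp add: a)
    from tangential_gradient_affine[OF x this] show ?thesis
      by (simp add: a)
  qed
  have "tangential_gradient \<sigma> (\<lambda>y. u y $ i) x \<bullet> tangential_gradient \<sigma> (\<lambda>y. w y $ i) x
      = (\<Sum>e\<in>Basis. A (F e) $ i * B (F e) $ i)" for i
  proof -
    have u': "tangential_gradient \<sigma> (\<lambda>y. u y $ i) x \<in> tangent_space \<sigma>"
      "\<And>t. t \<in> tangent_space \<sigma> \<Longrightarrow> tangential_gradient \<sigma> (\<lambda>y. u y $ i) x \<bullet> t = A t $ i"
      using comp[of A u b i, OF u(1)] u(2) by blast+
    have w': "tangential_gradient \<sigma> (\<lambda>y. w y $ i) x \<in> tangent_space \<sigma>"
      "\<And>t. t \<in> tangent_space \<sigma> \<Longrightarrow> tangential_gradient \<sigma> (\<lambda>y. w y $ i) x \<bullet> t = B t $ i"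
      using comp[of B w c i, OF w(1)] w(2) by blast+
    obtain p q where p: "tangential_gradient \<sigma> (\<lambda>y. u y $ i) x = F p"
      and q: "tangential_gradient \<sigma> (\<lambda>y. w y $ i) x = F q"
      using u'(1) w'(1) unfolding F(2)[symmetric] by blast
    have e: "F e \<in> tangent_space \<sigma>" for e
      using F(2) by blast
    have "F p \<bullet> F e = A (F e) $ i" "F q \<bullet> F e = B (F e) $ i" for e
      using u'(2)[OF e] w'(2)[OF e] by (simp_all only: p q)
    then have "p \<bullet> e = A (F e) $ i" "q \<bullet> e = B (F e) $ i" for e
      unfolding F(1) by blast+
    then have "p \<bullet> q = (\<Sum>e\<in>Basis. A (F e) $ i * B (F e) $ i)"
      by (subst euclidean_inner) (simp only:)
    then show ?thesis
      by (simp only: p q F(1))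
  qed
  then have "gradient_product \<sigma> u w x = (\<Sum>i\<in>UNIV. \<Sum>e\<in>Basis. A (F e) $ i * B (F e) $ i)"
    unfolding gradient_product_def by (intro sum.cong refl)
  also have "\<dots> = (\<Sum>e\<in>Basis. \<Sum>i\<in>UNIV. A (F e) $ i * B (F e) $ i)"
    by (rule sum.swap)
  also have "\<dots> = (\<Sum>e\<in>Basis. A (F e) \<bullet> B (F e))"
    by (simp add: inner_vec_def)
  finally show ?thesis .
qed

section \<open>The area of an affine image of a simplex\<close>

text \<open>Transport to the parameter space: the factor of proportionality between area and Lebesgue measure
  is the same for every isometric embedding \<open>f\<close>.\<close>

lemma hausdorff_measure_isometric_image:
  fixes f :: "real ^ 'n \<Rightarrow> real ^ 'd"
  assumes f: "\<And>x y. dist (f x) (f y) = dist x y"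
    and S: "S \<in> sets borel" "f ` S \<in> sets borel"
  shows "measure (hausdorff_measure CARD('n)) (f ` S) =
    measure (hausdorff_measure CARD('n)) (cbox 0 (One :: real ^ 'n)) * measure lborel S"
proof -
  have "emeasure (hausdorff_measure CARD('n)) (f ` S) = emeasure (hausdorff_measure DIM(real ^ 'n)) S"
    using S by (simp add: emeasure_hausdorff_measure hausdorff_outer_isometric_image[OF f])
  also have "\<dots> = emeasure (hausdorff_measure DIM(real ^ 'n)) (cbox 0 (One :: real ^ 'n)) * emeasure lborel S"
    by (rule hausdorff_measure_eq_lborel[OF S(1)])
  finally show ?thesis
    by (simp add: measure_def enn2real_mult)
qed

lemma open_simplex_affine_image:
  fixes A :: "real ^ 'd::finite \<Rightarrow> real ^ 'd"
  assumes "linear A" and X: "\<And>y. y \<in> convex hull \<sigma> \<Longrightarrow> X y = A y + b"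
  shows "open_simplex (X ` \<sigma>) = X ` open_simplex \<sigma>"
proof -
  have "X ` \<sigma> = (+) b ` A ` \<sigma>"
    unfolding image_image by (intro image_cong) (auto simp: X hull_inc)
  then have "convex hull (X ` \<sigma>) = (+) b ` A ` (convex hull \<sigma>)"
    by (simp add: convex_hull_translation convex_hull_linear_image[OF assms(1)])
  then have "open_simplex (X ` \<sigma>) = (+) b ` A ` open_simplex \<sigma>"
    by (simp add: open_simplex_def rel_interior_translation rel_interior_convex_linear_image[OF assms(1)])
  also have "\<dots> = X ` open_simplex \<sigma>"
    unfolding image_image
  proof (intro image_cong)
    fix y assume "y \<in> open_simplex \<sigma>"
    then show "b + A y = X y"
      using X[OF subsetD[OF open_simplex_subset(1)]] by (simp add: add.commute)
  qed simp
  finally show ?thesis .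
qed

lemma tangent_space_affine_image:
  assumes "linear A" and X: "\<And>y. y \<in> convex hull \<sigma> \<Longrightarrow> X y = A y + b" and "t \<in> tangent_space \<sigma>"
  shows "A t \<in> tangent_space (X ` \<sigma>)"
proof -
  have "A ` {x - y | x y. x \<in> \<sigma> \<and> y \<in> \<sigma>} \<subseteq> {x - y | x y. x \<in> X ` \<sigma> \<and> y \<in> X ` \<sigma>}"
  proof safe
    fix x y assume xy: "x \<in> \<sigma>" "y \<in> \<sigma>"
    then have "A (x - y) = X x - X y"
      by (simp add: X hull_inc linear_diff[OF assms(1)])
    with xy show "\<exists>x' y'. A (x - y) = x' - y' \<and> x' \<in> X ` \<sigma> \<and> y' \<in> X ` \<sigma>"
      by (intro exI[of _ "X x"] exI[of _ "X y"]) simp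
  qed
  moreover have "A t \<in> span (A ` {x - y | x y. x \<in> \<sigma> \<and> y \<in> \<sigma>})"
    unfolding linear_span_image[OF assms(1)] using assms(3) by (simp add: tangent_space_def)
  ultimately show ?thesis
    unfolding tangent_space_def using span_mono by blast
qed

lemma bounded_open_simplex: "finite \<sigma> \<Longrightarrow> bounded (open_simplex \<sigma>)"
  by (meson bounded_subset finite_imp_bounded_convex_hull open_simplex_subset(1))

text \<open>\<open>F\<close> parametrizes the tangent space of \<open>\<sigma>\<close>, and \<open>G\<close> in the proof that of the image simplex, which has
  the same dimension because the image is nondegenerate. In these coordinates \<open>X\<close> acts as the linear
  map \<open>B\<close> of \<open>\<real>\<^sup>n\<close>, so the change of Lebesgue measure under linear maps applies. The sort
  \<open>wellorder\<close> of the index type comes from that theorem. The identity on norms is all that the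
  energy estimate needs to know about \<open>B\<close>.\<close>

lemma simplex_area_affine_image:
  fixes X A :: "real ^ 'd::finite \<Rightarrow> real ^ 'd"
    and F :: "real ^ 'n::{finite,wellorder} \<Rightarrow> real ^ 'd"
  assumes \<sigma>: "card \<sigma> = CARD('d)" and \<sigma>': "card (X ` \<sigma>) = CARD('d)" "\<not> affine_dependent (X ` \<sigma>)"
    and A: "linear A" "\<And>y. y \<in> convex hull \<sigma> \<Longrightarrow> X y = A y + b"
    and F: "linear F" "\<And>x. norm (F x) = norm x" "range F = tangent_space \<sigma>"
    and n: "CARD('n) = CARD('d) - 1"
  obtains B where "linear B" "\<And>x. norm (B x) = norm (A (F x))"
    "simplex_area (X ` \<sigma>) = \<bar>det (matrix B)\<bar> * simplex_area \<sigma>"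
proof -
  have fin: "finite \<sigma>" "\<sigma> \<noteq> {}"
    using \<sigma> by (auto intro: card_ge_0_finite)
  then obtain p where p: "p \<in> \<sigma>"
    by blast
  have dim: "dim (UNIV :: (real ^ 'n::_) set) = dim (tangent_space (X ` \<sigma>))"
    using dim_tangent_space[OF \<sigma>'(2)] \<sigma>'(1) fin n by simp
  let ?V = "tangent_space (X ` \<sigma>)"
  have "\<exists>(G :: real ^ 'n::_ \<Rightarrow> real ^ 'd) g. linear G \<and> linear g \<and> (\<forall>x. norm (G x) = norm x) \<and>
      (\<forall>y\<in>?V. norm (g y) = norm y \<and> G (g y) = y)"
  proof (rule isometries_subspaces[OF subspace_UNIV subspace_tangent_space dim])
    fix G :: "real ^ 'n::_ \<Rightarrow> real ^ 'd" and g
    assume "linear G" "linear g" "\<And>x. x \<in> UNIV \<Longrightarrow> norm (G x) = norm x"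
      "\<And>y. y \<in> ?V \<Longrightarrow> norm (g y) = norm y" "\<And>y. y \<in> ?V \<Longrightarrow> G (g y) = y"
    then show ?thesis
      by (intro exI[of _ G] exI[of _ g]) simp
  qed
  then obtain G :: "real ^ 'n::_ \<Rightarrow> real ^ 'd" and g
    where G: "linear G" and g: "linear g" and Gn: "\<And>x. norm (G x) = norm x"
      and gn: "\<And>y. y \<in> ?V \<Longrightarrow> norm (g y) = norm y" and Gg: "\<And>y. y \<in> ?V \<Longrightarrow> G (g y) = y"
    by blast
  define B where "B x = g (A (F x))" for x
  have tang: "A (F x) \<in> tangent_space (X ` \<sigma>)" for x
    by (rule tangent_space_affine_image[OF A]) (use F(3) in auto)
  have lin: "linear B"
    unfolding B_def using linear_compose[OF linear_compose[OF F(1) A(1)] g] by (simp add: o_def)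
  have norm: "norm (B x) = norm (A (F x))" for x
    unfolding B_def by (rule gn[OF tang])
  have GB: "G (B x) = A (F x)" for x
    unfolding B_def by (rule Gg[OF tang])
  define f f' where "f x = p + F x" and "f' y = X p + G y" for x y
  have iso: "dist (f x) (f y) = dist x y" "dist (f' x) (f' y) = dist x y" for x y
    using F(2)[of "x - y"] Gn[of "x - y"]
    by (simp_all add: f_def f'_def dist_norm linear_diff[OF F(1)] linear_diff[OF G])
  have meas: "f \<in> borel_measurable borel" "f' \<in> borel_measurable borel"
    unfolding f_def f'_def using F(1) G
    by (auto intro!: borel_measurable_continuous_onI continuous_on_add
        simp: linear_continuous_on linear_conv_bounded_linear)
  define S where "S = f -` open_simplex \<sigma>"
  have fS: "f ` S = open_simplex \<sigma>"
  proof -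
    \<comment> \<open>The parametrization \<open>f\<close> reaches the whole affine hull of \<open>\<sigma>\<close>.\<close>
    have "open_simplex \<sigma> \<subseteq> range f"
    proof
      fix y assume "y \<in> open_simplex \<sigma>"
      then have "y - p \<in> range F"
        unfolding F(3) using open_simplex_subset(2) p
        by (intro affine_hull_diff_in_tangent_space) (auto intro: hull_inc)
      then obtain x where "y - p = F x"
        by blast
      then have "y = f x"
        by (simp add: f_def algebra_simps)
      then show "y \<in> range f"
        by blast
    qed
    then show ?thesis
      unfolding S_def by (simp add: image_vimage_eq Int_absorb2)
  qed
  have f'S: "f' ` B ` S = open_simplex (X ` \<sigma>)"
  proof -
    have "f' (B x) = X (f x)" if "x \<in> S" for x
    proof -
      have "f x \<in> convex hull \<sigma>"
        using that open_simplex_subset(1) by (auto simp: S_def)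
      then have "X (f x) = A (f x) + b" "X p = A p + b"
        using p by (auto intro!: A(2) hull_inc)
      then show ?thesis
        by (simp add: f_def f'_def GB linear_add[OF A(1)])
    qed
    then have "f' ` B ` S = X ` f ` S"
      by (simp add: image_image)
    then show ?thesis
      by (simp add: fS open_simplex_affine_image[OF A])
  qed
  have S: "S \<in> sets borel"
    unfolding S_def using measurable_sets_borel[OF meas(1) open_simplex_borel] by simp
  have "inj f'"
    by (metis iso(2) dist_eq_0_iff injI)
  then have "B ` S = f' -` open_simplex (X ` \<sigma>)"
    unfolding f'S[symmetric] by (simp add: inj_vimage_image_eq)
  then have BS: "B ` S \<in> sets borel"
    using measurable_sets_borel[OF meas(2) open_simplex_borel] by simp
  have "bounded S"
  proof -
    obtain r where r: "\<And>y. y \<in> open_simplex \<sigma> \<Longrightarrow> dist p y \<le> r"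
      using bounded_open_simplex[OF fin(1)] by (metis bounded_any_center)
    have "dist 0 x \<le> r" if "x \<in> S" for x
      using r[of "f x"] that F(2)[of x] by (simp add: S_def f_def dist_norm)
    then show ?thesis
      unfolding bounded_def by blast
  qed
  then have "S \<in> lmeasurable"
    using S by (intro bounded_set_imp_lmeasurable) auto
  then have "measure lebesgue (B ` S) = \<bar>det (matrix B)\<bar> * measure lebesgue S"
    by (rule measure_linear_image[OF lin])
  then have "measure lborel (B ` S) = \<bar>det (matrix B)\<bar> * measure lborel S"
    using S BS by (simp add: measure_completion)
  then have "simplex_area (X ` \<sigma>) = \<bar>det (matrix B)\<bar> * simplex_area \<sigma>"
    unfolding simplex_area_def n[symmetric]
    using hausdorff_measure_isometric_image[OF iso(1) S] hausdorff_measure_isometric_image[OF iso(2) BS]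
    by (simp add: fS f'S open_simplex_borel)
  then show thesis
    using that lin norm by blast
qed

lemma sum_Basis_axis: "(\<Sum>e\<in>Basis. f (e :: real ^ 'n)) = (\<Sum>i\<in>UNIV. f (axis i 1))"
proof -
  have "(Basis :: (real ^ 'n) set) = (\<lambda>i. axis i 1) ` UNIV"
    by (auto simp: Basis_vec_def)
  moreover have "inj (\<lambda>i :: 'n. axis i (1 :: real))"
    by (simp add: inj_on_def axis_eq_axis)
  ultimately show ?thesis
    by (metis (no_types, lifting) sum.reindex_cong)
qed

text \<open>The pointwise comparison of area and energy, \<open>|a| \<le> (a\<^sup>2 + 1) / 2\<close> for curves. The form of the right
  hand side is chosen such that the same expression serves for surfaces.\<close>

lemma abs_det_le_energy_1:
  fixes B :: "real ^ 1 \<Rightarrow> real ^ 1"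
  shows "\<bar>det (matrix B)\<bar> \<le> ((\<Sum>e\<in>Basis. (norm (B e))\<^sup>2) - real CARD(1)) / 2 + 1"
proof -
  define a where "a = B (axis 1 1) $ 1"
  have "0 \<le> (\<bar>a\<bar> - 1)\<^sup>2"
    by simp
  then have "\<bar>a\<bar> \<le> (a\<^sup>2 - 1) / 2 + 1"
    by (simp add: power2_diff field_simps)
  moreover have "(norm (B (axis 1 1)))\<^sup>2 = a\<^sup>2"
    unfolding power2_norm_eq_inner inner_vec_def by (simp add: a_def power2_eq_square)
  ultimately show ?thesis
    by (simp add: sum_Basis_axis det_1 matrix_def a_def)
qed

text \<open>For surfaces the constants cancel, and \<open>|a d - b c| \<le> |a d| + |b c|\<close> is at most half of the sum of
  the squares.\<close>

lemma abs_det_le_energy_2: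
  fixes B :: "real ^ 2 \<Rightarrow> real ^ 2"
  shows "\<bar>det (matrix B)\<bar> \<le> ((\<Sum>e\<in>Basis. (norm (B e))\<^sup>2) - real CARD(2)) / 2 + 1"
proof -
  define a b c d where "a = B (axis 1 1) $ 1" "b = B (axis 2 1) $ 1"
    "c = B (axis 1 1) $ 2" "d = B (axis 2 1) $ 2"
  have "0 \<le> (\<bar>a\<bar> - \<bar>d\<bar>)\<^sup>2" "0 \<le> (\<bar>b\<bar> - \<bar>c\<bar>)\<^sup>2"
    by simp_all
  then have "\<bar>a * d\<bar> + \<bar>b * c\<bar> \<le> (a\<^sup>2 + c\<^sup>2 + (b\<^sup>2 + d\<^sup>2)) / 2"
    by (simp add: power2_diff abs_mult field_simps)
  with abs_triangle_ineq4 have "\<bar>a * d - b * c\<bar> \<le> (a\<^sup>2 + c\<^sup>2 + (b\<^sup>2 + d\<^sup>2)) / 2"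
    by (rule order_trans)
  then have "\<bar>a * d - b * c\<bar> \<le> (a\<^sup>2 + c\<^sup>2 + (b\<^sup>2 + d\<^sup>2) - 2) / 2 + 1"
    by (simp add: diff_divide_distrib)
  moreover have "(norm (B (axis 1 1)))\<^sup>2 = a\<^sup>2 + c\<^sup>2" "(norm (B (axis 2 1)))\<^sup>2 = b\<^sup>2 + d\<^sup>2"
    unfolding power2_norm_eq_inner inner_vec_def by (simp_all add: sum_2 a_b_c_d_def power2_eq_square)
  ultimately show ?thesis
    by (simp add: sum_Basis_axis det_2 matrix_def sum_2 a_b_c_d_def)
qed

section \<open>Finite element functions and mass lumping\<close>

lemma simplex_area_nonneg: "0 \<le> simplex_area \<sigma>"
  by (simp add: simplex_area_def)

lemma fe_vector_space_affine:
  assumes v: "v \<in> fe_vector_space G" and \<sigma>: "\<sigma> \<in> simplices G"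
  obtains A b where "linear A" "\<And>y. y \<in> convex hull \<sigma> \<Longrightarrow> v y = A y + b"
proof -
  have "\<forall>i. \<exists>a c. \<forall>y\<in>convex hull \<sigma>. v y $ i = a \<bullet> y + c"
    using v \<sigma> by (simp add: fe_vector_space_def fe_space_def)
  then obtain a c where ac: "\<And>i y. y \<in> convex hull \<sigma> \<Longrightarrow> v y $ i = a i \<bullet> y + c i"
    by metis
  show thesis
  proof
    show "linear (\<lambda>y. \<chi> i. a i \<bullet> y)"
      by (intro linearI) (simp_all add: vec_eq_iff inner_add_right)
    show "v y = (\<chi> i. a i \<bullet> y) + (\<chi> i. c i)" if "y \<in> convex hull \<sigma>" for y
      using ac[OF that] by (simp add: vec_eq_iff)
  qed
qed

lemma fe_vector_space_tendsto_vertex: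
  assumes v: "v \<in> fe_vector_space G" and \<sigma>: "\<sigma> \<in> simplices G" "q \<in> \<sigma>"
  shows "(v \<longlongrightarrow> v q) (at q within open_simplex \<sigma>)"
proof (rule vec_tendstoI)
  fix i
  have "continuous_on (points G) (\<lambda>x. v x $ i)"
    using v by (simp add: fe_vector_space_def fe_space_def)
  moreover have "q \<in> points G"
    using \<sigma> by (auto simp: points_def intro: hull_inc)
  ultimately have "((\<lambda>x. v x $ i) \<longlongrightarrow> v q $ i) (at q within points G)"
    by (simp add: continuous_on_def)
  moreover have "open_simplex \<sigma> \<subseteq> points G"
    using \<sigma>(1) open_simplex_subset(1)[of \<sigma>] unfolding points_def by blast
  ultimately show "((\<lambda>x. v x $ i) \<longlongrightarrow> v q $ i) (at q within open_simplex \<sigma>)"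
    by (rule tendsto_within_subset)
qed

lemma fe_vector_space_scaleR:
  assumes "v \<in> fe_vector_space G"
  shows "(\<lambda>x. c *\<^sub>R v x) \<in> fe_vector_space G"
  unfolding fe_vector_space_def fe_space_def
proof (intro CollectI allI conjI ballI)
  fix i
  have "continuous_on (points G) (\<lambda>x. v x $ i)"
    using assms by (simp add: fe_vector_space_def fe_space_def)
  then show "continuous_on (points G) (\<lambda>x. (c *\<^sub>R v x) $ i)"
    by (simp add: continuous_on_mult_left)
  fix \<sigma> assume "\<sigma> \<in> simplices G"
  then obtain a b where "\<And>x. x \<in> convex hull \<sigma> \<Longrightarrow> v x $ i = a \<bullet> x + b"
    using assms unfolding fe_vector_space_def fe_space_def by blast
  then show "\<exists>a b. \<forall>x\<in>convex hull \<sigma>. (c *\<^sub>R v x) $ i = a \<bullet> x + b"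
    by (intro exI[of _ "c *\<^sub>R a"] exI[of _ "c * b"]) (simp add: distrib_left)
qed

text \<open>A vertex is a limit point of the open simplex as soon as there is a second vertex; so limits at
  vertices from inside the simplex are unique.\<close>

lemma at_vertex_within_open_simplex:
  assumes "q \<in> \<sigma>" "r \<in> \<sigma>" "q \<noteq> r"
  shows "at q within open_simplex \<sigma> \<noteq> bot"
proof -
  have "q \<in> convex hull \<sigma>" "r \<in> convex hull \<sigma>"
    using assms by (auto intro: hull_inc)
  then have "q islimpt convex hull \<sigma>"
    using assms(3) by (intro connected_imp_perfect convex_connected) auto
  then have "q islimpt closure (open_simplex \<sigma>)"
    unfolding open_simplex_def convex_closure_rel_interior[OF convex_convex_hull]
    by (rule islimpt_subset[OF _ closure_subset])
  then show ?thesis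
    by (simp add: limpt_of_closure trivial_limit_within)
qed

lemma lumped_eq:
  assumes "\<And>\<sigma> q. \<sigma> \<in> simplices G \<Longrightarrow> q \<in> \<sigma> \<Longrightarrow> at q within open_simplex \<sigma> \<noteq> bot"
    and "\<And>\<sigma> q. \<sigma> \<in> simplices G \<Longrightarrow> q \<in> \<sigma> \<Longrightarrow>
      ((\<lambda>x. \<eta> x \<bullet> \<xi> x) \<longlongrightarrow> L \<sigma> q) (at q within open_simplex \<sigma>)"
  shows "lumped G \<eta> \<xi> = 1 / real CARD('d) * (\<Sum>\<sigma>\<in>simplices (G :: 'd::finite discrete_surface).
    simplex_area \<sigma> * (\<Sum>q\<in>\<sigma>. L \<sigma> q))"
proof -
  have "Lim (at q within open_simplex \<sigma>) (\<lambda>x. \<eta> x \<bullet> \<xi> x) = L \<sigma> q"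
    if "\<sigma> \<in> simplices G" "q \<in> \<sigma>" for \<sigma> q
    by (rule tendsto_Lim[OF assms[OF that]])
  then show ?thesis
    unfolding lumped_def by (simp cong: sum.cong)
qed

section \<open>Decrease of the area\<close>

text \<open>The test function in the velocity equation is the displacement \<open>\<tau> v\<close> itself, and each of the two
  lumped terms is then nonnegative. If the lumped norm of \<open>T\<close> is \<open>0\<close>, the quotient has the
  value \<open>0\<close>, which is nonnegative as well.\<close>

lemma dirichlet_form_velocity_nonpos:
  fixes G :: "'d::finite discrete_surface"
  assumes d: "CARD('d) \<ge> 2" and G: "conforming_simplices G" "unit_normal_field G"
    and "\<tau> > 0" "\<alpha> > 0" and T: "T \<in> fe_vector_space G"
    and v: "solves_velocity_problem \<tau> \<alpha> G T v"
  shows "dirichlet_form G (\<lambda>x. \<tau> *\<^sub>R v x + x) (\<lambda>x. \<tau> *\<^sub>R v x) \<le> 0"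
proof -
  let ?n = "normal G"
  have vfe: "v \<in> fe_vector_space G"
    using v by (simp add: solves_velocity_problem_def)
  have nt: "at q within open_simplex \<sigma> \<noteq> bot" if "\<sigma> \<in> simplices G" "q \<in> \<sigma>" for \<sigma> q
  proof -
    have "2 \<le> card \<sigma>"
      using that G(1) d by (simp add: conforming_simplices_def)
    then have "\<not> \<sigma> \<subseteq> {q}"
      using card_mono[of "{q}" \<sigma>] by auto
    then obtain r where "r \<in> \<sigma>" "r \<noteq> q"
      by blast
    then show ?thesis
      using that(2) by (intro at_vertex_within_open_simplex) auto
  qed
  have "\<forall>\<sigma>\<in>simplices G. \<exists>\<nu>. \<forall>x\<in>open_simplex \<sigma>. ?n x = \<nu>"
    using G(2) unfolding unit_normal_field_def by blast
  then obtain \<nu> where \<nu>: "\<And>\<sigma> x. \<sigma> \<in> simplices G \<Longrightarrow> x \<in> open_simplex \<sigma> \<Longrightarrow> ?n x = \<nu> \<sigma>"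
    by metis
  have nlim: "(?n \<longlongrightarrow> \<nu> \<sigma>) (at q within open_simplex \<sigma>)" if "\<sigma> \<in> simplices G" for \<sigma> q
    by (rule tendsto_eventually) (auto simp: eventually_at_filter \<nu>[OF that])
  note vlim = fe_vector_space_tendsto_vertex[OF vfe]
  note Tlim = fe_vector_space_tendsto_vertex[OF T]
  have "lumped G (\<lambda>x. v x \<bullet> ?n x) (\<lambda>x. ?n x \<bullet> (\<tau> *\<^sub>R v x))
      = 1 / real CARD('d) * (\<Sum>\<sigma>\<in>simplices G. simplex_area \<sigma> * (\<Sum>q\<in>\<sigma>. (v q \<bullet> \<nu> \<sigma>) \<bullet> (\<nu> \<sigma> \<bullet> (\<tau> *\<^sub>R v q))))"
    by (rule lumped_eq[OF nt]) (assumption+ | intro tendsto_intros vlim nlim)+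
  also have "\<dots> \<ge> 0"
    using \<open>\<tau> > 0\<close> by (intro mult_nonneg_nonneg sum_nonneg simplex_area_nonneg)
      (simp_all add: inner_commute mult.left_commute[of _ \<tau>])
  finally have normal_nonneg: "0 \<le> lumped G (\<lambda>x. v x \<bullet> ?n x) (\<lambda>x. ?n x \<bullet> (\<tau> *\<^sub>R v x))" .
  have "lumped G T (\<lambda>x. \<tau> *\<^sub>R v x)
      = 1 / real CARD('d) * (\<Sum>\<sigma>\<in>simplices G. simplex_area \<sigma> * (\<Sum>q\<in>\<sigma>. T q \<bullet> (\<tau> *\<^sub>R v q)))"
    by (rule lumped_eq[OF nt]) (assumption+ | intro tendsto_intros vlim Tlim)+
  moreover have "lumped G v T
      = 1 / real CARD('d) * (\<Sum>\<sigma>\<in>simplices G. simplex_area \<sigma> * (\<Sum>q\<in>\<sigma>. v q \<bullet> T q))"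
    by (rule lumped_eq[OF nt]) (assumption+ | intro tendsto_intros vlim Tlim)+
  ultimately have scale: "lumped G T (\<lambda>x. \<tau> *\<^sub>R v x) = \<tau> * lumped G v T"
    by (simp add: inner_commute mult.left_commute flip: sum_distrib_left)
  have "lumped G T T
      = 1 / real CARD('d) * (\<Sum>\<sigma>\<in>simplices G. simplex_area \<sigma> * (\<Sum>q\<in>\<sigma>. T q \<bullet> T q))"
    by (rule lumped_eq[OF nt]) (assumption+ | intro tendsto_intros Tlim)+
  also have "\<dots> \<ge> 0"
    by (intro mult_nonneg_nonneg sum_nonneg simplex_area_nonneg) simp_all
  finally have "0 \<le> lumped_norm G T"
    by (simp add: lumped_norm_def)
  then have "0 \<le> lumped G v T * lumped G T (\<lambda>x. \<tau> *\<^sub>R v x) / (\<alpha> * lumped_norm G T)"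
    using \<open>\<tau> > 0\<close> \<open>\<alpha> > 0\<close> by (simp add: scale mult.left_commute[of _ \<tau>])
  moreover have "dirichlet_form G (\<lambda>x. \<tau> *\<^sub>R v x + x) (\<lambda>x. \<tau> *\<^sub>R v x)
      + lumped G (\<lambda>x. v x \<bullet> ?n x) (\<lambda>x. ?n x \<bullet> (\<tau> *\<^sub>R v x))
      + lumped G v T * lumped G T (\<lambda>x. \<tau> *\<^sub>R v x) / (\<alpha> * lumped_norm G T) = 0"
    using v fe_vector_space_scaleR[OF vfe, of \<tau>] unfolding solves_velocity_problem_def by blast
  ultimately show ?thesis
    using normal_nonneg by linarith
qed

text \<open>With \<open>A'\<close> the linear part of \<open>X = id + w\<close> and \<open>F e\<close> an orthonormal basis of the tangent space, the
  integrand is the constant \<open>K\<close>, the sum of \<open>A' (F e) \<bullet> (A' (F e) - F e)\<close>. Each summand is at least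
  \<open>(|A' (F e)|\<^sup>2 - 1) / 2\<close>, the difference being half the square of \<open>|A' (F e) - F e|\<close>, and
  \<open>det\<close> compares the sum of these lower bounds with the area factor.\<close>

lemma simplex_area_increase_le:
  fixes w :: "real ^ 'd::finite \<Rightarrow> real ^ 'd"
  assumes det: "\<And>B :: real ^ 'n::{finite,wellorder} \<Rightarrow> real ^ 'n::_. linear B \<Longrightarrow>
      \<bar>det (matrix B)\<bar> \<le> ((\<Sum>e\<in>Basis. (norm (B e))\<^sup>2) - real CARD('n)) / 2 + 1"
    and n: "CARD('n) = CARD('d) - 1"
    and \<sigma>: "card \<sigma> = CARD('d)" "\<not> affine_dependent \<sigma>"
    and \<sigma>': "card ((\<lambda>x. w x + x) ` \<sigma>) = CARD('d)" "\<not> affine_dependent ((\<lambda>x. w x + x) ` \<sigma>)"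
    and A: "linear A" "\<And>y. y \<in> convex hull \<sigma> \<Longrightarrow> w y = A y + b"
  shows "simplex_area ((\<lambda>x. w x + x) ` \<sigma>) - simplex_area \<sigma> \<le>
    (LINT x : open_simplex \<sigma> | hausdorff_measure (CARD('d) - 1). gradient_product \<sigma> (\<lambda>x. w x + x) w x)"
proof -
  define X where "X = (\<lambda>x. w x + x)"
  have "\<sigma> \<noteq> {}"
    using \<sigma>(1) by auto
  then have dim: "dim (UNIV :: (real ^ 'n::_) set) = dim (tangent_space \<sigma>)"
    using dim_tangent_space[OF \<sigma>(2)] \<sigma>(1) n by simp
  obtain F :: "real ^ 'n::_ \<Rightarrow> real ^ 'd"
    where F: "linear F" "range F = tangent_space \<sigma>" "\<And>x. x \<in> UNIV \<Longrightarrow> norm (F x) = norm x"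
    using isometry_subspaces[OF subspace_UNIV subspace_tangent_space dim] by blast
  have Fn: "norm (F x) = norm x" for x
    by (rule F(3)) simp
  define A' where "A' y = A y + y" for y
  have A': "linear A'" "\<And>y. y \<in> convex hull \<sigma> \<Longrightarrow> X y = A' y + b"
    using A by (auto simp: X_def A'_def[abs_def] intro: linear_compose_add linear_ident)
  obtain B where B: "linear B" "\<And>x. norm (B x) = norm (A' (F x))"
    and area: "simplex_area (X ` \<sigma>) = \<bar>det (matrix B)\<bar> * simplex_area \<sigma>"
    using simplex_area_affine_image[OF \<sigma>(1) \<sigma>'[folded X_def] A' F(1) Fn F(2) n] by metis
  define K where "K = (\<Sum>e\<in>Basis. A' (F e) \<bullet> A (F e))"
  have gp: "gradient_product \<sigma> X w x = K" if "x \<in> open_simplex \<sigma>" for x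
    unfolding K_def using that
    by (rule gradient_product_affine[OF _ linear_isometry_inner[OF F(1) Fn] F(2) A' A])
  have "\<bar>det (matrix B)\<bar> - 1 \<le> ((\<Sum>e\<in>Basis. (norm (B e))\<^sup>2) - real CARD('n)) / 2"
    using det[OF B(1)] by linarith
  also have "\<dots> = (\<Sum>e\<in>(Basis :: (real ^ 'n::_) set). ((norm (B e))\<^sup>2 - 1) / 2)"
    by (simp add: sum_subtractf flip: sum_divide_distrib)
  also have "\<dots> \<le> K"
    unfolding K_def
  proof (rule sum_mono)
    fix e :: "real ^ 'n::_" assume e: "e \<in> Basis"
    have "F e \<bullet> F e = 1"
      using Fn[of e] e by (simp add: norm_eq_1 flip: power2_norm_eq_inner)
    moreover have "0 \<le> (A (F e)) \<bullet> (A (F e))"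
      by simp
    ultimately show "((norm (B e))\<^sup>2 - 1) / 2 \<le> A' (F e) \<bullet> A (F e)"
      by (simp add: B(2) A'_def power2_norm_eq_inner inner_add_left inner_add_right inner_commute)
  qed
  finally have le: "(\<bar>det (matrix B)\<bar> - 1) * simplex_area \<sigma> \<le> K * simplex_area \<sigma>"
    by (rule mult_right_mono[OF _ simplex_area_nonneg])
  have "(LINT x : open_simplex \<sigma> | hausdorff_measure (CARD('d) - 1). gradient_product \<sigma> X w x)
      = (\<integral>x. indicator (open_simplex \<sigma>) x * K \<partial>hausdorff_measure (CARD('d) - 1))"
    unfolding set_lebesgue_integral_def
    by (intro Bochner_Integration.integral_cong) (auto simp: gp indicator_def)
  also have "\<dots> = K * simplex_area \<sigma>"
    by (simp add: simplex_area_def)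
  finally show ?thesis
    using le unfolding X_def[symmetric] area left_diff_distrib by simp
qed

text \<open>Two simplices could have the same image, which then counts only once on the left hand side; for the
  upper bound this is harmless.\<close>

lemma surface_area_increase_le:
  fixes G :: "'d::finite discrete_surface"
  assumes det: "\<And>B :: real ^ 'n::{finite,wellorder} \<Rightarrow> real ^ 'n::_. linear B \<Longrightarrow>
      \<bar>det (matrix B)\<bar> \<le> ((\<Sum>e\<in>Basis. (norm (B e))\<^sup>2) - real CARD('n)) / 2 + 1"
    and n: "CARD('n) = CARD('d) - 1"
    and G: "conforming_simplices G" "conforming_simplices G'" and w: "w \<in> fe_vector_space G"
    and im: "simplices G' = image_simplices (\<lambda>x. w x + x) G"
  shows "surface_area G' - surface_area G \<le> dirichlet_form G (\<lambda>x. w x + x) w"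
proof -
  have "surface_area G' \<le> (\<Sum>\<sigma>\<in>simplices G. simplex_area ((\<lambda>x. w x + x) ` \<sigma>))"
    using G(1) sum_image_le[of "simplices G" simplex_area "(`) (\<lambda>x. w x + x)"]
    by (simp add: surface_area_def im image_simplices_def conforming_simplices_def simplex_area_nonneg o_def)
  moreover have "(\<Sum>\<sigma>\<in>simplices G. simplex_area ((\<lambda>x. w x + x) ` \<sigma>) - simplex_area \<sigma>)
      \<le> dirichlet_form G (\<lambda>x. w x + x) w"
    unfolding dirichlet_form_def
  proof (rule sum_mono)
    fix \<sigma> assume \<sigma>: "\<sigma> \<in> simplices G"
    then have "(\<lambda>x. w x + x) ` \<sigma> \<in> simplices G'"
      by (simp add: im image_simplices_def)
    moreover obtain A b where "linear A" "\<And>y. y \<in> convex hull \<sigma> \<Longrightarrow> w y = A y + b"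
      using fe_vector_space_affine[OF w \<sigma>] by blast
    ultimately show "simplex_area ((\<lambda>x. w x + x) ` \<sigma>) - simplex_area \<sigma> \<le>
        (LINT x : open_simplex \<sigma> | hausdorff_measure (CARD('d) - 1). gradient_product \<sigma> (\<lambda>x. w x + x) w x)"
      using G \<sigma> unfolding conforming_simplices_def
      by (intro simplex_area_increase_le[OF det n]) auto
  qed
  ultimately show ?thesis
    by (simp add: surface_area_def sum_subtractf)
qed

theorem theorem2p3:
  fixes \<Gamma> :: "nat \<Rightarrow> 'd::finite discrete_surface"
    and T v :: "nat \<Rightarrow> real ^ 'd \<Rightarrow> real ^ 'd"
    and \<tau> \<alpha> :: real
    and N :: nat
  assumes "CARD('d) \<in> {2, 3}"
    and "\<tau> > 0" and "\<alpha> > 0"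
    and "\<And>m. m \<in> {0..N} \<Longrightarrow> closed_discrete_surface (\<Gamma> m)"
    and "\<And>m. m \<in> {1..N} \<Longrightarrow> solves_T_problem (\<Gamma> (m - 1)) (T (m - 1))"
    and "\<And>m. m \<in> {1..N} \<Longrightarrow> \<exists>x\<in>points (\<Gamma> (m - 1)). T (m - 1) x \<noteq> 0"
    and "\<And>m. m \<in> {1..N} \<Longrightarrow> solves_velocity_problem \<tau> \<alpha> (\<Gamma> (m - 1)) (T (m - 1)) (v m)"
    and "\<And>m. m \<in> {1..N} \<Longrightarrow>
      simplices (\<Gamma> m) = image_simplices (\<lambda>x. x + \<tau> *\<^sub>R v m x) (\<Gamma> (m - 1))"
  shows "\<forall>m\<in>{1..N}. surface_area (\<Gamma> m) \<le> surface_area (\<Gamma> (m - 1))"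
proof
  fix m assume m: "m \<in> {1..N}"
  let ?G = "\<Gamma> (m - 1)" and ?w = "\<lambda>x. \<tau> *\<^sub>R v m x"
  have closed: "closed_discrete_surface ?G" "closed_discrete_surface (\<Gamma> m)"
    using m by (auto intro!: assms(4))
  have G: "conforming_simplices ?G" "unit_normal_field ?G" "conforming_simplices (\<Gamma> m)"
    using closed by (simp_all add: closed_discrete_surface_def)
  have T: "T (m - 1) \<in> fe_vector_space ?G"
    using assms(5)[OF m] by (simp add: solves_T_problem_def)
  have w: "?w \<in> fe_vector_space ?G"
    using assms(7)[OF m] by (intro fe_vector_space_scaleR) (simp add: solves_velocity_problem_def)
  have im: "simplices (\<Gamma> m) = image_simplices (\<lambda>x. ?w x + x) ?G"
    using assms(8)[OF m] by (simp add: add.commute)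
  have "surface_area (\<Gamma> m) - surface_area ?G \<le> dirichlet_form ?G (\<lambda>x. ?w x + x) ?w"
  proof (cases "CARD('d) = 2")
    case True
    then show ?thesis
      by (intro surface_area_increase_le[where 'n = 1, OF abs_det_le_energy_1 _ G(1,3) w im]) simp
  next
    case False
    then have "CARD('d) = 3"
      using assms(1) by simp
    then show ?thesis
      by (intro surface_area_increase_le[where 'n = 2, OF abs_det_le_energy_2 _ G(1,3) w im]) simp
  qed
  also have "\<dots> \<le> 0"
    using assms(1) by (intro dirichlet_form_velocity_nonpos[OF _ G(1,2) assms(2,3) T assms(7)[OF m]]) auto
  finally show "surface_area (\<Gamma> m) \<le> surface_area ?G"
    by simp
qed

end
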